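(* Let $l,m$ be positive even integers, let non-zero weights $a_{\xi\eta},b_{\xi\eta},c_{\xi\eta},d_{\xi\eta}\in\mathbb C$ be attached to the links of the $l\times m$ square lattice on the torus, let $A,B,C,D$ be the corresponding operators, and let $x,y$ be the monomials in $u,v$ attached to two basis cycles of the torus (all as in the context). Let $f(x,y)$ be the determinant $\det\bigl(\mathbf 1+uAB^{-1}-vDB^{-1}-uvCB^{-1}\bigr)$ and $s(x,y)$ the normalized statistical sum of the inhomogeneous dimer model, both considered as functions of $x$ and $y$. Then $$s(x,y)=\tfrac12\bigl(-f(x,y)+f(-x,y)+f(x,-y)+f(-x,-y)\bigr),$$ $$f(x,y)=\tfrac12\bigl(-s(x,y)+s(-x,y)+s(x,-y)+s(-x,-y)\bigr).$$
   Context: Lattice: vertices are $(\xi,\eta)\in\mathbb Z/l\times\mathbb Z/m$; a vertex is "white" if $\xi+\eta$ is even and "black" if it is odd. From every white vertex $(\xi,\eta)$ there go four links: an $A$-link to $(\xi+1,\eta)$ with number $a_{\xi\eta}$, a $B$-link to $(\xi,\eta+1)$ with number $b_{\xi\eta}$, a $C$-link to $(\xi,\eta-1)$ with number $c_{\xi\eta}$, and a $D$-link to $(\xi-1,\eta)$ with number $d_{\xi\eta}$. (If $l=2$ or $m=2$, links joining the same two vertices are still regarded as distinct links.) Operators: let $\mathcal H_1$, $\mathcal H_2$ be the complex vector spaces with bases $e_{\xi\eta}$ indexed by white, respectively black, vertices. $A,B,C,D:\mathcal H_1\to\mathcal H_2$ are given on white basis vectors by $Ae_{\xi\eta}=a_{\xi\eta}e_{\xi+1,\eta}$,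 $Be_{\xi\eta}=b_{\xi\eta}e_{\xi,\eta+1}$, $Ce_{\xi\eta}=c_{\xi\eta}e_{\xi,\eta-1}$, $De_{\xi\eta}=d_{\xi\eta}e_{\xi-1,\eta}$. Dimer model: a dimer configuration is a set of links such that every vertex belongs to exactly one link of the set. The weight of an $A$-link is $ua_{\xi\eta}$, of a $B$-link $-b_{\xi\eta}$, of a $C$-link $-uvc_{\xi\eta}$, of a $D$-link $-vd_{\xi\eta}$. The weight of a configuration is the product of the weights of its links; the statistical sum is the sum of the weights of all dimer configurations. The normalized statistical sum is the statistical sum multiplied by $\prod(-b_{\xi\eta}^{-1})$ over all $B$-links. Variables $x,y$: identify $H_1$ of the torus with $l\mathbb Z\times m\mathbb Z$ (total displacement of a closed path). To a cycle $(p,q)$ attach the monomial $u^{(p-q)/2}v^{-(p+q)/2}$ (this is the power of $u,v$ picked up by a closed path of that class which alternately goes from a black vertex down along a $B$-link, with weight $b^{-1}$, and from a white vertex along an $A$-, $C$- or $D$-link with weight $ua$, $-uvc$ or $-vd$). Choose a basis of $H_1$ of the torus consisting of two cycles; $x$ and $y$ are the two monomials attached to them. They are algebraically independent, and both the determinant and the normalized statistical sum are (Laurent) polynomials in $x,y$; $f(x,y)$, $s(x,y)$ denote these Laurent polynomials. *)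

theory Defs
  imports
    "HOL-Library.Poly_Mapping"
    "HOL-Library.Product_Plus"
    "Jordan_Normal_Form.Determinant"
    "Jordan_Normal_Form.Gauss_Jordan_Elimination"
begin

section \<open>The lattice on the torus\<close>

text \<open>Elements of \<open>\<int>/l \<times> \<int>/m\<close> are given by their representatives in
  \<open>{0..<l} \<times> {0..<m}\<close>; the parity of \<open>\<xi> + \<eta>\<close> is well defined because \<open>l\<close> and \<open>m\<close> are even.
  The lists fix the order of the two bases.\<close>

type_synonym vertex = "int \<times> int"

definition white_vertices :: "int \<Rightarrow> int \<Rightarrow> vertex list" where
  "white_vertices l m = filter (\<lambda>(\<xi>, \<eta>). even (\<xi> + \<eta>)) (List.product [0..l - 1] [0..m - 1])"

definition black_vertices :: "int \<Rightarrow> int \<Rightarrow> vertex list" where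
  "black_vertices l m = filter (\<lambda>(\<xi>, \<eta>). odd (\<xi> + \<eta>)) (List.product [0..l - 1] [0..m - 1])"

datatype link_kind = LinkA | LinkB | LinkC | LinkD

fun link_target :: "int \<Rightarrow> int \<Rightarrow> link_kind \<Rightarrow> vertex \<Rightarrow> vertex" where
  "link_target l m LinkA (\<xi>, \<eta>) = ((\<xi> + 1) mod l, \<eta>)"
| "link_target l m LinkB (\<xi>, \<eta>) = (\<xi>, (\<eta> + 1) mod m)"
| "link_target l m LinkC (\<xi>, \<eta>) = (\<xi>, (\<eta> - 1) mod m)"
| "link_target l m LinkD (\<xi>, \<eta>) = ((\<xi> - 1) mod l, \<eta>)"

text \<open>A link is its kind together with its white end, so that links joining the same two
  vertices (when \<open>l = 2\<close> or \<open>m = 2\<close>) stay distinct.\<close>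

type_synonym link = "link_kind \<times> vertex"

definition links :: "int \<Rightarrow> int \<Rightarrow> link set" where
  "links l m = UNIV \<times> set (white_vertices l m)"

fun link_ends :: "int \<Rightarrow> int \<Rightarrow> link \<Rightarrow> vertex set" where
  "link_ends l m (k, z) = {z, link_target l m k z}"

section \<open>Laurent polynomials in two variables\<close>

text \<open>\<open>Poly_Mapping.single (i, j) \<alpha>\<close> is the Laurent monomial with coefficient \<open>\<alpha>\<close> and exponents
  \<open>i\<close> and \<open>j\<close>. The same type is used for Laurent polynomials in \<open>u, v\<close> and in \<open>x, y\<close>.\<close>

type_synonym laurent = "(int \<times> int) \<Rightarrow>\<^sub>0 complex"

definition lconst :: "complex \<Rightarrow> laurent" where
  "lconst \<alpha> = Poly_Mapping.single (0, 0) \<alpha>"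

definition var_u :: laurent where
  "var_u = Poly_Mapping.single (1, 0) 1"

definition var_v :: laurent where
  "var_v = Poly_Mapping.single (0, 1) 1"

text \<open>\<open>lsubst \<alpha> e \<beta> e' g\<close> is \<open>g(X, Y)\<close> where \<open>X\<close> and \<open>Y\<close> are the invertible monomials with
  nonzero coefficients \<open>\<alpha>\<close>, \<open>\<beta>\<close> and exponent vectors \<open>e\<close>, \<open>e'\<close>.\<close>

definition lsubst :: "complex \<Rightarrow> int \<times> int \<Rightarrow> complex \<Rightarrow> int \<times> int \<Rightarrow> laurent \<Rightarrow> laurent" where
  "lsubst \<alpha> e \<beta> e' g =
     (\<Sum>(i, j)\<in>Poly_Mapping.keys g.
        Poly_Mapping.single (i * fst e + j * fst e', i * snd e + j * snd e')
          (Poly_Mapping.lookup g (i, j) * \<alpha> powi i * \<beta> powi j))"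

text \<open>\<open>sign_change \<epsilon> \<delta> g\<close> is \<open>g(\<epsilon> x, \<delta> y)\<close>.\<close>

definition sign_change :: "complex \<Rightarrow> complex \<Rightarrow> laurent \<Rightarrow> laurent" where
  "sign_change \<epsilon> \<delta> g = lsubst \<epsilon> (1, 0) \<delta> (0, 1) g"

section \<open>The operators and the determinant\<close>

text \<open>Matrix of the operator \<open>\<H>\<^sub>1 \<rightarrow> \<H>\<^sub>2\<close> that sends the basis vector at a white
  vertex \<open>z\<close> to \<open>w z\<close> times the basis vector at the black end of the link of kind \<open>k\<close> from \<open>z\<close>.\<close>

definition link_operator ::
    "int \<Rightarrow> int \<Rightarrow> link_kind \<Rightarrow> (vertex \<Rightarrow> complex) \<Rightarrow> complex mat" where
  "link_operator l m k w =
     mat (length (black_vertices l m)) (length (white_vertices l m))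
       (\<lambda>(i, j). if black_vertices l m ! i = link_target l m k (white_vertices l m ! j)
                 then w (white_vertices l m ! j) else 0)"

text \<open>\<open>det (1 + u A B\<^sup>-\<^sup>1 - v D B\<^sup>-\<^sup>1 - u v C B\<^sup>-\<^sup>1)\<close> as a Laurent polynomial in \<open>u, v\<close>. For nonzero
  \<open>b\<close> the operator \<open>B\<close> is invertible, so \<open>the\<close> is applied to a \<open>Some\<close>.\<close>

definition lattice_det :: "int \<Rightarrow> int \<Rightarrow> (vertex \<Rightarrow> complex) \<Rightarrow> (vertex \<Rightarrow> complex) \<Rightarrow>
    (vertex \<Rightarrow> complex) \<Rightarrow> (vertex \<Rightarrow> complex) \<Rightarrow> laurent" where
  "lattice_det l m a b c d =
     (let A = link_operator l m LinkA a;
          B = link_operator l m LinkB b;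
          C = link_operator l m LinkC c;
          D = link_operator l m LinkD d;
          Binv = the (mat_inverse B)
      in det (1\<^sub>m (length (black_vertices l m))
              + var_u \<cdot>\<^sub>m map_mat lconst (A * Binv)
              - var_v \<cdot>\<^sub>m map_mat lconst (D * Binv)
              - (var_u * var_v) \<cdot>\<^sub>m map_mat lconst (C * Binv)))"

section \<open>The dimer model\<close>

definition dimer_configuration :: "int \<Rightarrow> int \<Rightarrow> link set \<Rightarrow> bool" where
  "dimer_configuration l m S \<longleftrightarrow>
     S \<subseteq> links l m \<and>
     (\<forall>z \<in> set (white_vertices l m) \<union> set (black_vertices l m). \<exists>!e. e \<in> S \<and> z \<in> link_ends l m e)"

fun link_weight :: "(vertex \<Rightarrow> complex) \<Rightarrow> (vertex \<Rightarrow> complex) \<Rightarrow>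
    (vertex \<Rightarrow> complex) \<Rightarrow> (vertex \<Rightarrow> complex) \<Rightarrow> link \<Rightarrow> laurent" where
  "link_weight a b c d (LinkA, z) = var_u * lconst (a z)"
| "link_weight a b c d (LinkB, z) = - lconst (b z)"
| "link_weight a b c d (LinkC, z) = - (var_u * var_v * lconst (c z))"
| "link_weight a b c d (LinkD, z) = - (var_v * lconst (d z))"

definition statistical_sum :: "int \<Rightarrow> int \<Rightarrow> (vertex \<Rightarrow> complex) \<Rightarrow> (vertex \<Rightarrow> complex) \<Rightarrow>
    (vertex \<Rightarrow> complex) \<Rightarrow> (vertex \<Rightarrow> complex) \<Rightarrow> laurent" where
  "statistical_sum l m a b c d =
     (\<Sum>S | dimer_configuration l m S. \<Prod>e\<in>S. link_weight a b c d e)"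

definition normalized_statistical_sum :: "int \<Rightarrow> int \<Rightarrow> (vertex \<Rightarrow> complex) \<Rightarrow>
    (vertex \<Rightarrow> complex) \<Rightarrow> (vertex \<Rightarrow> complex) \<Rightarrow> (vertex \<Rightarrow> complex) \<Rightarrow> laurent" where
  "normalized_statistical_sum l m a b c d =
     statistical_sum l m a b c d * (\<Prod>z\<in>set (white_vertices l m). lconst (- inverse (b z)))"

section \<open>Homology of the torus and the variables \<open>x, y\<close>\<close>

definition torus_cycle :: "int \<Rightarrow> int \<Rightarrow> int \<times> int \<Rightarrow> bool" where
  "torus_cycle l m P \<longleftrightarrow> l dvd fst P \<and> m dvd snd P"

definition torus_homology_basis :: "int \<Rightarrow> int \<Rightarrow> int \<times> int \<Rightarrow> int \<times> int \<Rightarrow> bool" where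
  "torus_homology_basis l m P Q \<longleftrightarrow>
     torus_cycle l m P \<and> torus_cycle l m Q \<and>
     (\<forall>R. torus_cycle l m R \<longrightarrow>
        (\<exists>!n. R = (fst n * fst P + snd n * fst Q, fst n * snd P + snd n * snd Q)))"

text \<open>Exponents of \<open>u\<close> and \<open>v\<close> in \<open>u\<^bsup>(p-q)/2\<^esup> v\<^bsup>-(p+q)/2\<^esup>\<close>. The divisions are exact for the
  cycles considered, as \<open>p\<close> and \<open>q\<close> are multiples of the even numbers \<open>l\<close> and \<open>m\<close>.\<close>

fun cycle_exponents :: "int \<times> int \<Rightarrow> int \<times> int" where
  "cycle_exponents (p, q) = ((p - q) div 2, - ((p + q) div 2))"

text \<open>\<open>in_variables_uv P Q g\<close> is the Laurent polynomial in \<open>u, v\<close> obtained from \<open>g(x, y)\<close> when \<open>x\<close>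
  and \<open>y\<close> are the monomials attached to the cycles \<open>P\<close> and \<open>Q\<close>.\<close>

definition in_variables_uv :: "int \<times> int \<Rightarrow> int \<times> int \<Rightarrow> laurent \<Rightarrow> laurent" where
  "in_variables_uv P Q g = lsubst 1 (cycle_exponents P) 1 (cycle_exponents Q) g"

end

theory Submission
  imports Defs
begin

text \<open>Send a white vertex along its link of a dimer configuration and then down the \<open>B\<close>-link:
  this is a permutation of the white vertices, and expanding the determinant gives the same terms
  as the statistical sum, each multiplied by \<open>(-1)\<^sup>n\<close>, where \<open>n\<close> counts the cycles that use
  links other than \<open>B\<close>-links. In the coordinates given by the exponents of \<open>u\<close> and \<open>v\<close> the
  permutation lifts to a periodic bijection of \<open>\<int>\<^sup>2\<close> with steps in \<open>{0, 1}\<^sup>2\<close>. Its orbits do not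
  cross, so they are the level sets of a height function, and \<open>n\<close> is the positive generator of
  the group of increments of the height along the periods. These increments are the intersection
  numbers with the total class \<open>(i, j)\<close> of the cycles, hence \<open>n = gcd(i, j)\<close>. So the coefficient
  of \<open>x\<^sup>i y\<^sup>j\<close> in \<open>f\<close> is the one in \<open>s\<close> if \<open>i\<close> and \<open>j\<close> are both even and its negative otherwise,
  which is what the averages over sign changes express.\<close>

section \<open>Signs of permutations\<close>

text \<open>Multiplying \<open>p\<close> by the transposition of \<open>x\<close> and \<open>p x\<close> splits off the fixed point \<open>x\<close>,
  which changes the sign and either leaves the set of labels unchanged or, if \<open>p x = x\<close>, removes
  the label of \<open>x\<close>.\<close>

lemma sign_eq_card_labels:
  fixes p :: "'a \<Rightarrow> 'a" and lab :: "'a \<Rightarrow> 'b"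
  assumes "finite M" "p permutes M"
    and "\<And>x. x \<in> M \<Longrightarrow> lab (p x) = lab x"
    and "\<And>x y. x \<in> M \<Longrightarrow> y \<in> M \<Longrightarrow> lab x = lab y \<Longrightarrow> \<exists>n. (p ^^ n) x = y \<or> (p ^^ n) y = x"
  shows "sign p = (-1) ^ (card M + card (lab ` M))"
  using assms
proof (induction M arbitrary: p rule: finite_induct)
  case empty
  then show ?case by (simp add: permutes_empty)
next
  case (insert x M)
  define q where "q = transpose x (p x) \<circ> p"
  have px: "p x \<in> insert x M"
    using permutes_in_image[OF insert.prems(1), of x] by blast
  have perm_q: "q permutes M"
  proof -
    have "q permutes insert x M"
      unfolding q_def using px by (intro permutes_compose insert.prems permutes_swap_id) auto
    moreover have "q x = x" by (simp add: q_def)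
    ultimately show ?thesis
      by (metis insert.hyps(2) permutes_superset insertE Diff_iff insertCI)
  qed
  have q_eq: "q y = (if p y = x then p x else p y)" if "y \<in> M" for y
    using that insert.hyps insert.prems(1)
    by (auto simp: q_def transpose_def dest: permutes_inj injD)
  have lab_q: "lab (q y) = lab y" if "y \<in> M" for y
    using that insert.prems(2)[of y] insert.prems(2)[of x] by (auto simp: q_eq)
  \<comment> \<open>A \<open>p\<close>-path inside \<open>M\<close> may pass through
    \<open>x\<close>, where \<open>q\<close> goes from the predecessor of \<open>x\<close> straight
    to \<open>p x\<close>. Such a detour uses up two steps of \<open>p\<close>, hence the strong
    induction.\<close>
  have reach: "\<exists>k. (q ^^ k) y = z" if "(p ^^ n) y = z" "y \<in> M" "z \<in> M" for n y z
    using that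
  proof (induction n arbitrary: y rule: less_induct)
    case (less n)
    show ?case
    proof (cases n)
      case 0
      then show ?thesis using less.prems by (intro exI[of _ 0]) auto
    next
      case (Suc n')
      show ?thesis
      proof (cases "p y = x")
        case False
        then have "p y \<in> M"
          using less.prems insert.prems(1) by (metis insertE insertI2 permutes_in_image)
        with less.IH[of n' "p y"] Suc less.prems obtain k where "(q ^^ k) (p y) = z"
          by (auto simp: funpow_swap1)
        with False less.prems show ?thesis
          by (intro exI[of _ "Suc k"]) (simp add: funpow_Suc_right q_eq del: funpow.simps)
      next
        case True
        have "n' \<noteq> 0"
        proof
          assume "n' = 0"
          then have "z = x" using True Suc less.prems by simp
          then show False using less.prems insert.hyps by simp
        qed
        then obtain n'' where n'': "n' = Suc n''" by (cases n') auto
        have pxM: "p x \<in> M"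
        proof -
          have "p x \<noteq> x"
            using True less.prems insert.hyps insert.prems(1) by (metis permutes_inj injD)
          then show ?thesis using px by simp
        qed
        have "(p ^^ n'') (p x) = z"
          using less.prems(1) True Suc n'' by (simp add: funpow_Suc_right del: funpow.simps)
        with less.IH[of n'' "p x"] Suc n'' less.prems pxM obtain k where "(q ^^ k) (p x) = z"
          by auto
        with True less.prems show ?thesis
          by (intro exI[of _ "Suc k"]) (simp add: funpow_Suc_right q_eq del: funpow.simps)
      qed
    qed
  qed
  have IH: "sign q = (-1) ^ (card M + card (lab ` M))"
  proof (rule insert.IH[OF perm_q lab_q])
    fix y z assume yz: "y \<in> M" "z \<in> M" "lab y = lab z"
    then obtain n where "(p ^^ n) y = z \<or> (p ^^ n) z = y"
      using insert.prems(3)[of y z] by auto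
    then show "\<exists>n. (q ^^ n) y = z \<or> (q ^^ n) z = y"
      using reach yz by blast
  qed
  have "p = transpose x (p x) \<circ> q"
    by (simp add: q_def fun_eq_iff)
  then have "sign p = sign (transpose x (p x)) * sign q"
    using perm_q insert.hyps(1)
    by (metis permutation_swap_id permutes_imp_permutation sign_compose)
  then have sign_p: "sign p = (if p x = x then 1 else -1) * sign q"
    by (simp add: sign_swap_id eq_commute)
  show ?case
  proof (cases "p x = x")
    case True
    have px_n: "(p ^^ n) x = x" for n
      using True by (induction n) auto
    have "lab x \<notin> lab ` M"
    proof
      assume "lab x \<in> lab ` M"
      then obtain y where y: "y \<in> M" "lab x = lab y" by auto
      then obtain n where "(p ^^ n) x = y \<or> (p ^^ n) y = x"
        using insert.prems(3)[of x y] by auto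
      then have "y = x"
        using px_n insert.prems(1) by (metis bij_betw_def bij_fn inj_eq permutes_bij)
      then show False using y insert.hyps by simp
    qed
    then show ?thesis using True IH sign_p insert.hyps by simp
  next
    case False
    then have "lab x \<in> lab ` M"
      using px insert.prems(2)[of x] by (metis imageI insertE insertI1)
    then have "lab ` insert x M = lab ` M" by auto
    then show ?thesis using False IH sign_p insert.hyps by simp
  qed
qed

text \<open>Conjugation by \<open>e\<close> preserves signs. It carries the Leibniz formula from
  index sets \<open>{0..<n}\<close> over to permutations of the white vertices.\<close>

lemma sum_permutes_reindex:
  fixes F :: "'a \<Rightarrow> 'a \<Rightarrow> 'b :: comm_ring_1"
  assumes bij: "bij_betw e A W" and fin: "finite A"
  shows "(\<Sum>p | p permutes A. of_int (sign p) * (\<Prod>j\<in>A. F (e (p j)) (e j))) =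
    (\<Sum>q | q permutes W. of_int (sign q) * (\<Prod>z\<in>W. F (q z) z))"
proof (rule sum.reindex_bij_witness[where j = "map_permutation A e"
      and i = "map_permutation W (inv_into A e)"])
  have bij': "bij_betw (inv_into A e) W A" using bij by (rule bij_betw_inv_into)
  have inj: "inj_on e A" using bij by (rule bij_betw_imp_inj_on)
  {
    fix p assume "p \<in> {p. p permutes A}"
    then have p: "p permutes A" by simp
    show "map_permutation W (inv_into A e) (map_permutation A e p) = p"
      using bij p inj by (intro map_permutation_compose_inv) auto
    show "map_permutation A e p \<in> {q. q permutes W}"
      using map_permutation_permutes[OF bij p] by simp
    have "(\<Prod>z\<in>W. F (map_permutation A e p z) z) = (\<Prod>j\<in>A. F (map_permutation A e p (e j)) (e j))"
      by (rule prod.reindex_bij_betw[OF bij, symmetric])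
    also have "\<dots> = (\<Prod>j\<in>A. F (e (p j)) (e j))"
      using inj by (intro prod.cong) (simp_all add: map_permutation_apply)
    finally show "of_int (sign (map_permutation A e p)) * (\<Prod>z\<in>W. F (map_permutation A e p z) z) =
        of_int (sign p) * (\<Prod>j\<in>A. F (e (p j)) (e j))"
      using sign_map_permutation[OF inj p fin] by simp
  }
  {
    fix q assume "q \<in> {q. q permutes W}"
    then have q: "q permutes W" by simp
    show "map_permutation A e (map_permutation W (inv_into A e) q) = q"
      using bij' q bij by (intro map_permutation_compose_inv) (auto simp: bij_betw_def f_inv_into_f)
    show "map_permutation W (inv_into A e) q \<in> {p. p permutes A}"
      using map_permutation_permutes[OF bij' q] by simp
  }
qed

section \<open>Monotone step bijections of the plane\<close>

lemma int_antidifference: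
  fixes g :: "int \<Rightarrow> int"
  obtains G where "G 0 = 0" "\<And>x. G (x + 1) = G x + g x"
proof -
  define G where "G = (\<lambda>x. if x \<ge> 0 then \<Sum>k\<in>{0..<x}. g k else - (\<Sum>k\<in>{x..<0}. g k))"
  have "G (x + 1) = G x + g x" for x
  proof (cases "x \<ge> 0")
    case True
    then have "{0..<x + 1} = insert x {0..<x}" by auto
    with True show ?thesis by (simp add: G_def)
  next
    case False
    then have "{x..<0} = insert x {x + 1..<0}" by auto
    with False show ?thesis by (cases "x = -1") (auto simp: G_def)
  qed
  moreover have "G 0 = 0" by (simp add: G_def)
  ultimately show ?thesis using that by blast
qed

text \<open>Discrete Poincare lemma: \<open>h\<close> is integrated along the axis
  \<open>j = 0\<close> and then vertically; closedness on each unit square carries the horizontal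
  rule from one row to the next.\<close>

lemma closed_form_exact:
  fixes f g :: "int \<Rightarrow> int \<Rightarrow> int"
  assumes closed: "\<And>i j. f i j + g (i + 1) j = g i j + f i (j + 1)"
  obtains h where "\<And>i j. h (i + 1) j = h i j + f i j" "\<And>i j. h i (j + 1) = h i j + g i j"
proof -
  obtain F where F: "\<And>i. F (i + 1) = F i + f i 0"
    using int_antidifference[of "\<lambda>i. f i 0"] by metis
  have "\<exists>G. G 0 = 0 \<and> (\<forall>j. G (j + 1) = G j + g i j)" for i
    using int_antidifference[of "g i"] by metis
  then obtain G where G: "\<And>i. G i 0 = 0" "\<And>i j. G i (j + 1) = G i j + g i j"
    by metis
  have horiz: "F (i + 1) + G (i + 1) j = F i + G i j + f i j" for i j
  proof (induction j rule: int_induct[where k = 0])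
    case base
    then show ?case by (simp add: G F)
  next
    case (step1 j)
    then show ?case using closed[of i j] by (simp add: G(2))
  next
    case (step2 j)
    then show ?case using closed[of i "j - 1"] G(2)[of i "j - 1"] G(2)[of "i + 1" "j - 1"] by simp
  qed
  show ?thesis
    by (rule that[of "\<lambda>i j. F i + G i j"]) (simp_all add: horiz G(2))
qed

section \<open>The flow of the orbits across unit segments\<close>

locale monotone_step_bijection =
  fixes p :: "int \<times> int \<Rightarrow> int \<times> int"
  assumes bij_p: "bij p"
    and p_step: "p (i, j) \<in> {(i, j), (i + 1, j), (i, j + 1), (i + 1, j + 1)}"
begin

text \<open>The segment from \<open>(i - 1, j)\<close> to \<open>(i, j)\<close>, displaced slightly
  right and down, is crossed exactly by the upward or diagonal steps that end in
  \<open>(i, j)\<close>. Likewise \<open>leaves_right i j\<close> counts the steps across the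
  displaced segment from \<open>(i, j)\<close> to \<open>(i, j + 1)\<close>.\<close>

definition enters_up :: "int \<Rightarrow> int \<Rightarrow> int" where
  "enters_up i j = of_bool (p (i, j - 1) = (i, j)) + of_bool (p (i - 1, j - 1) = (i, j))"

definition leaves_right :: "int \<Rightarrow> int \<Rightarrow> int" where
  "leaves_right i j = of_bool (p (i, j) = (i + 1, j)) + of_bool (p (i, j) = (i + 1, j + 1))"

lemma p_eq_iff: "p z = p w \<longleftrightarrow> z = w"
  using bij_p by (auto simp: bij_def inj_eq)

lemma leaves_right_bounds: "0 \<le> leaves_right i j" "leaves_right i j \<le> 1"
  by (auto simp: leaves_right_def)

lemma enters_up_bounds: "0 \<le> enters_up i j" "enters_up i j \<le> 1"
  using p_eq_iff[of "(i, j - 1)" "(i - 1, j - 1)"] by (auto simp: enters_up_def)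

lemma predecessor_cases:
  obtains "p (i, j) = (i, j)" | "p (i - 1, j) = (i, j)" | "p (i, j - 1) = (i, j)"
    | "p (i - 1, j - 1) = (i, j)"
proof -
  obtain i' j' where pred: "p (i', j') = (i, j)"
    using bij_p by (metis bij_def surj_def surj_pair)
  then have "(i', j') \<in> {(i, j), (i - 1, j), (i, j - 1), (i - 1, j - 1)}"
    using p_step[of i' j'] by auto
  with pred that show ?thesis by auto
qed

text \<open>Kirchhoff's law: as \<open>p\<close> is a bijection, a moved point has one outgoing and
  one incoming nontrivial step, a fixed point none.\<close>

lemma flow_conservation:
  "of_bool (p (i, j) = (i + 1, j)) + of_bool (p (i, j) = (i, j + 1))
      + of_bool (p (i, j) = (i + 1, j + 1))
   = (of_bool (p (i - 1, j) = (i, j)) + of_bool (p (i, j - 1) = (i, j))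
      + of_bool (p (i - 1, j - 1) = (i, j)) :: int)" (is "?out = ?in")
proof -
  have "?out = of_bool (p (i, j) \<noteq> (i, j))"
    using p_step[of i j] by auto
  also have "\<dots> = ?in"
    using p_eq_iff[of "(i, j)" "(i - 1, j)"] p_eq_iff[of "(i, j)" "(i, j - 1)"]
      p_eq_iff[of "(i, j)" "(i - 1, j - 1)"] p_eq_iff[of "(i - 1, j)" "(i, j - 1)"]
      p_eq_iff[of "(i - 1, j)" "(i - 1, j - 1)"] p_eq_iff[of "(i, j - 1)" "(i - 1, j - 1)"]
    by (cases i j rule: predecessor_cases) auto
  finally show ?thesis .
qed

text \<open>The predecessor of a moved point is another point. A right step from it counts in
  \<open>leaves_right (i - 1) j\<close>, the other kinds count in \<open>enters_up i j\<close>. This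
  forces a strict rise of the height at moved points.\<close>

lemma moved_out: "p (i, j) \<noteq> (i, j) \<Longrightarrow> enters_up i j = 1 \<or> leaves_right (i - 1) j = 1"
  using enters_up_bounds[of i j]
  by (cases i j rule: predecessor_cases) (auto simp: enters_up_def leaves_right_def)

lemma enters_up_moved: "enters_up i j = 1 \<Longrightarrow> p (i, j) \<noteq> (i, j)"
  using p_eq_iff[of "(i, j)" "(i, j - 1)"] p_eq_iff[of "(i, j)" "(i - 1, j - 1)"]
  by (auto simp: enters_up_def)

lemma leaves_right_moved: "leaves_right i j = 1 \<Longrightarrow> p (i, j) \<noteq> (i, j)"
  by (auto simp: leaves_right_def)

text \<open>Conservation at \<open>(i + 1, j)\<close>, where the diagonal step out of
  \<open>(i, j)\<close> cancels on the right. It says that the flow is a closed form and so has a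
  height.\<close>

lemma enters_up_leaves_right_closed:
  "enters_up (i + 1) j + - leaves_right (i + 1) j = - leaves_right i j + enters_up (i + 1) (j + 1)"
  using flow_conservation[of "i + 1" j] by (simp add: enters_up_def leaves_right_def)

lemma moved_iterate: "p z \<noteq> z \<Longrightarrow> p (p z) \<noteq> p z"
  by (simp add: p_eq_iff)

end

section \<open>Orbits as level sets of the height\<close>

text \<open>\<open>h\<close> counts with sign the orbits crossed on the way to a point, where every point is
  regarded as lying slightly to the right of and below the orbit through it.\<close>

locale step_bijection_height = monotone_step_bijection +
  fixes h :: "int \<Rightarrow> int \<Rightarrow> int"
  assumes h_right: "h (i + 1) j = h i j + enters_up (i + 1) j"
    and h_up: "h i (j + 1) = h i j - leaves_right i j"
begin

text \<open>A step crosses no other orbit. For right and up steps the increment is zero because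
  predecessor and successor are unique; for a diagonal step, going up changes the height by -1 and
  going right by +1.\<close>

lemma h_invariant:
  assumes "p (i, j) = (i', j')"
  shows "h i' j' = h i j"
proof -
  have "(i', j') \<in> {(i, j), (i + 1, j), (i, j + 1), (i + 1, j + 1)}"
    using p_step[of i j] assms by simp
  then consider "i' = i" "j' = j" | "i' = i + 1" "j' = j" | "i' = i" "j' = j + 1"
    | "i' = i + 1" "j' = j + 1" by auto
  then show ?thesis
  proof cases
    case 2
    with assms have "enters_up (i + 1) j = 0"
      using p_eq_iff[of "(i, j)" "(i + 1, j - 1)"] p_eq_iff[of "(i, j)" "(i, j - 1)"]
      by (auto simp: enters_up_def)
    with 2 show ?thesis by (simp add: h_right)
  next
    case 3
    with assms show ?thesis by (simp add: h_up leaves_right_def)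
  next
    case 4
    with assms have "enters_up (i + 1) (j + 1) = 1" "leaves_right i j = 1"
      using p_eq_iff[of "(i, j)" "(i + 1, j)"] by (auto simp: enters_up_def leaves_right_def)
    with 4 show ?thesis using h_right[of i "j + 1"] h_up[of i j] by simp
  qed simp
qed

lemma antidiagonal_step: "h i j = h (i - 1) (j + 1) + leaves_right (i - 1) j + enters_up i j"
  using h_right[of "i - 1" j] h_up[of "i - 1" j] by simp

text \<open>All steps go weakly right and up, so a move to the lower right along an antidiagonal
  crosses orbits in the positive direction only.\<close>

lemma antidiagonal_mono:
  assumes "i \<le> i'" "i + j = i' + j'"
  shows "h i j \<le> h i' j'"
proof -
  have "h (i' - int n) (j' + int n) \<le> h i' j'" for n
  proof (induction n)
    case (Suc n)
    have "h (i' - int (Suc n)) (j' + int (Suc n)) \<le> h (i' - int n) (j' + int n)"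
      using antidiagonal_step[of "i' - int n" "j' + int n"]
        leaves_right_bounds(1)[of "i' - int n - 1" "j' + int n"]
        enters_up_bounds(1)[of "i' - int n" "j' + int n"]
      by (simp add: algebra_simps)
    with Suc show ?case by linarith
  qed simp
  from this[of "nat (i' - i)"] assms show ?thesis
    by (simp add: algebra_simps) (metis add_diff_cancel_left' add.commute)
qed

lemma antidiagonal_strict:
  assumes "p (i', j') \<noteq> (i', j')" "i < i'" "i + j = i' + j'"
  shows "h i j < h i' j'"
proof -
  have "h i j \<le> h (i' - 1) (j' + 1)"
    using assms by (intro antidiagonal_mono) auto
  also have "\<dots> < h i' j'"
    using antidiagonal_step[of i' j'] moved_out[OF assms(1)] leaves_right_bounds[of "i' - 1" j']
      enters_up_bounds[of i' j'] by linarith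
  finally show ?thesis .
qed

lemma antidiagonal_inj:
  assumes "p (i, j) \<noteq> (i, j)" "p (i', j') \<noteq> (i', j')" "h i j = h i' j'" "i + j = i' + j'"
  shows "(i, j) = (i', j')"
  using antidiagonal_strict[OF assms(1), of i' j'] antidiagonal_strict[OF assms(2), of i j] assms
  by (cases i i' rule: linorder_cases) auto

text \<open>A path that jumps diagonally over an antidiagonal separates the remaining points of that
  antidiagonal by height.\<close>

lemma diagonal_jump_height:
  assumes jump: "p (i, j) = (i + 1, j + 1)" and moved: "p (i', j') \<noteq> (i', j')"
    and diag: "i' + j' = i + j + 1"
  shows "h i' j' \<noteq> h i j"
proof -
  have "leaves_right i j = 1" using jump by (simp add: leaves_right_def)
  then have up: "h i (j + 1) = h i j - 1" using h_up[of i j] by simp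
  consider "i' \<le> i" | "i' = i + 1" | "i' > i + 1" by linarith
  then show ?thesis
  proof cases
    case 1
    then show ?thesis
      using antidiagonal_mono[of i' i j' "j + 1"] up diag by simp
  next
    case 2
    have "j' = j" using 2 diag by simp
    \<comment> \<open>The left neighbour \<open>(i, j)\<close> jumps diagonally, so the point must
      be entered by an upward or diagonal step, which puts it one above
      \<open>h i j\<close>.\<close>
    then have "enters_up i' j' = 1"
      using moved 2 jump enters_up_bounds[of i' j'] by (cases i' j' rule: predecessor_cases) (auto simp: enters_up_def)
    then show ?thesis using h_right[of i j] 2 \<open>j' = j\<close> by simp
  next
    case 3
    have "h (i + 1) j \<ge> h i j" using h_right[of i j] enters_up_bounds[of "i + 1" j] by simp
    moreover have "h (i + 1) j < h i' j'"
      using antidiagonal_strict[OF moved, of "i + 1" j] 3 diag by simp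
    ultimately show ?thesis by simp
  qed
qed

text \<open>The orbit of \<open>z\<close> climbs through the antidiagonals without changing its
  height. It cannot jump over the antidiagonal of \<open>w\<close>, and on that antidiagonal a moved
  point is determined by its height.\<close>

lemma same_height_same_orbit:
  assumes "p z \<noteq> z" "p w \<noteq> w" "h (fst z) (snd z) = h (fst w) (snd w)"
    and "fst z + snd z \<le> fst w + snd w"
  shows "\<exists>n. (p ^^ n) z = w"
  using assms
proof (induction "nat (fst w + snd w - (fst z + snd z))" arbitrary: z rule: less_induct)
  case less
  obtain i j where z: "z = (i, j)" by force
  obtain i' j' where w: "w = (i', j')" by force
  obtain k l where pz: "p z = (k, l)" by force
  have kl: "(k, l) \<in> {(i + 1, j), (i, j + 1), (i + 1, j + 1)}"
    using p_step[of i j] less.prems(1) pz z by auto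
  show ?case
  proof (cases "i + j = i' + j'")
    case True
    then have "z = w" using antidiagonal_inj less.prems z w by simp
    then show ?thesis by (intro exI[of _ 0]) simp
  next
    case False
    then have lt: "i + j < i' + j'" using less.prems z w by simp
    \<comment> \<open>A step raises \<open>i + j\<close> by at most 2, so only a diagonal jump could
      overshoot, and then the heights would differ.\<close>
    have "k + l \<le> i' + j'"
    proof (rule ccontr)
      assume "\<not> k + l \<le> i' + j'"
      with kl lt have "(k, l) = (i + 1, j + 1)" "i' + j' = i + j + 1" by auto
      then show False
        using diagonal_jump_height[of i j i' j'] pz z w less.prems by auto
    qed
    moreover have "i + j < k + l" using kl by auto
    moreover have "h k l = h i' j'" using h_invariant[of i j k l] less.prems pz z w by simp
    moreover have "p (p z) \<noteq> p z" using less.prems(1) by (rule moved_iterate)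
    ultimately obtain n where "(p ^^ n) (p z) = w"
      using less.hyps[of "p z"] less.prems z w pz by auto
    then show ?thesis by (intro exI[of _ "Suc n"]) (simp add: funpow_Suc_right del: funpow.simps)
  qed
qed

text \<open>The flow is invariant under the period, so the height and its translate have the same
  increments and differ by a constant.\<close>

lemma period_shifts_height:
  assumes per: "\<And>i j. p (i + a, j + b) = p (i, j) + (a, b)"
  shows "h (i + a) (j + b) - h i j = h a b - h 0 0"
proof -
  have eq: "p (i + a, j + b) = (i' + a, j' + b) \<longleftrightarrow> p (i, j) = (i', j')" for i j i' j'
    using per[of i j] by (cases "p (i, j)") auto
  have up: "enters_up (i + a) (j + b) = enters_up i j" for i j
    using eq[of i "j - 1" i j] eq[of "i - 1" "j - 1" i j]
    by (simp add: enters_up_def algebra_simps)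
  have right: "leaves_right (i + a) (j + b) = leaves_right i j" for i j
    using eq[of i j "i + 1" j] eq[of i j "i + 1" "j + 1"]
    by (simp add: leaves_right_def algebra_simps)
  have stepi: "h (i + 1 + a) (j + b) - h (i + 1) j = h (i + a) (j + b) - h i j" for i j
    using h_right[of "i + a" "j + b"] h_right[of i j] up[of "i + 1" j] by (simp add: algebra_simps)
  have stepj: "h (i + a) (j + 1 + b) - h i (j + 1) = h (i + a) (j + b) - h i j" for i j
    using h_up[of "i + a" "j + b"] h_up[of i j] right[of i j] by (simp add: algebra_simps)
  have "h (i + a) (0 + b) - h i 0 = h a b - h 0 0" for i
  proof (induction i rule: int_induct[where k = 0])
    case (step1 i)
    then show ?case using stepi[of i 0] by simp
  next
    case (step2 i)
    then show ?case using stepi[of "i - 1" 0] by simp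
  qed simp
  moreover have "h (i + a) (j + b) - h i j = h (i + a) (0 + b) - h i 0"
  proof (induction j rule: int_induct[where k = 0])
    case (step1 j)
    then show ?case using stepj[of i j] by simp
  next
    case (step2 j)
    then show ?case using stepj[of i "j - 1"] by simp
  qed simp
  ultimately show ?thesis by simp
qed

text \<open>Translating back by the period stays on the antidiagonal, and the height strictly rises
  on the way to a moved point. This later excludes that all increments along periods vanish.\<close>

lemma antidiagonal_period_pos:
  assumes per: "\<And>i j. p (i + e, j + - e) = p (i, j) + (e, - e)" and "e > 0"
    and "p (i, j) \<noteq> (i, j)"
  shows "h e (- e) - h 0 0 > 0"
proof -
  have "h (i - e) (j + e) < h i j"
    using antidiagonal_strict[OF assms(3), of "i - e" "j + e"] assms(2) by simp
  then show ?thesis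
    using period_shifts_height[of e "- e" "i - e" "j + e", OF per] by simp
qed

text \<open>A discrete intermediate value argument: the period makes the height unbounded in both
  directions along an antidiagonal, and each unit rise ends at a moved point.\<close>

lemma every_height_moved:
  assumes per: "\<And>i j. p (i + e, j + - e) = p (i, j) + (e, - e)" and "e > 0"
    and moved: "p (i0, j0) \<noteq> (i0, j0)"
  shows "\<exists>i j. p (i, j) \<noteq> (i, j) \<and> h i j = c"
proof -
  define x where "x = h e (- e) - h 0 0"
  have x: "x \<ge> 1" using antidiagonal_period_pos[OF per assms(2,3)] by (simp add: x_def)
  have shift: "h (int n * e) (- (int n * e)) = h 0 0 + int n * x" for n
  proof (induction n)
    case (Suc n)
    then show ?case
      using period_shifts_height[of e "- e" "int n * e" "- (int n * e)", OF per]
      by (simp add: x_def algebra_simps)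
  qed simp
  have shift': "h (- (int n * e)) (int n * e) = h 0 0 - int n * x" for n
  proof (induction n)
    case (Suc n)
    then show ?case
      using period_shifts_height[of e "- e" "- (int (Suc n) * e)" "int (Suc n) * e", OF per]
      by (simp add: x_def algebra_simps)
  qed simp
  define H where "H = (\<lambda>k::int. h k (- k))"
  \<comment> \<open>Since \<open>x \<ge> 1\<close>, shifting by \<open>n\<close> periods in either
    direction takes the height from \<open>h 0 0\<close> past \<open>c\<close>.\<close>
  define n where "n = nat (\<bar>c\<bar> + \<bar>h 0 0\<bar> + 1)"
  have n: "int n * x \<ge> \<bar>c\<bar> + \<bar>h 0 0\<bar> + 1"
    using x mult_left_mono[of 1 x "int n"] by (simp add: n_def)
  have top: "H (int n * e) \<ge> c" and bot: "H (- (int n * e)) < c"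
    using shift[of n] shift'[of n] n by (simp_all add: H_def)
  have "\<exists>k. H k < c \<and> c \<le> H (k + 1)"
  proof (rule ccontr)
    assume none: "\<not> ?thesis"
    have "H (- (int n * e) + int r) < c" for r
    proof (induction r)
      case (Suc r)
      with none have "H (- (int n * e) + int r + 1) < c" by (metis not_le)
      then show ?case by (simp add: algebra_simps)
    qed (use bot in simp)
    from this[of "nat (2 * int n * e)"] show False
      using top assms(2) by (simp add: algebra_simps)
  qed
  then obtain k where k: "h k (- k) < c" "c \<le> h (k + 1) (- (k + 1))"
    by (auto simp: H_def)
  \<comment> \<open>The step along the antidiagonal is split at the corner
    \<open>(k, - (k + 1))\<close>. Each half raises the height by at most one, so \<open>c\<close>
    is attained exactly.\<close>
  have mid: "h (k + 1) (- (k + 1)) = h k (- (k + 1)) + enters_up (k + 1) (- (k + 1))"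
    "h k (- k) = h k (- (k + 1)) - leaves_right k (- (k + 1))"
    using h_right[of k "- (k + 1)"] h_up[of k "- (k + 1)"] by simp_all
  show ?thesis
  proof (cases "h k (- (k + 1)) \<ge> c")
    case True
    with k mid leaves_right_bounds[of k "- (k + 1)"]
    have "leaves_right k (- (k + 1)) = 1" "h k (- (k + 1)) = c" by linarith+
    then show ?thesis using leaves_right_moved by blast
  next
    case False
    with k mid enters_up_bounds[of "k + 1" "- (k + 1)"]
    have "enters_up (k + 1) (- (k + 1)) = 1" "h (k + 1) (- (k + 1)) = c" by linarith+
    then show ?thesis using enters_up_moved by blast
  qed
qed

end

context monotone_step_bijection
begin

lemma height_exists:
  obtains h where "step_bijection_height p h"
proof -
  obtain h where "\<And>i j. h (i + 1) j = h i j + enters_up (i + 1) j"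
    "\<And>i j. h i (j + 1) = h i j + - leaves_right i j"
    using closed_form_exact[of "\<lambda>i j. enters_up (i + 1) j" "\<lambda>i j. - leaves_right i j"]
      enters_up_leaves_right_closed by metis
  then have "step_bijection_height p h"
    by unfold_locales auto
  then show ?thesis using that by blast
qed

end

section \<open>Matchings of the torus\<close>

lemma link_kind_UNIV: "(UNIV :: link_kind set) = {LinkA, LinkB, LinkC, LinkD}"
  by (auto intro: link_kind.exhaust)

lemma finite_link_kind [simp]: "finite (UNIV :: link_kind set)"
  by (simp add: link_kind_UNIV)

text \<open>The exponents of \<open>u\<close> and \<open>v\<close> in the weight of a link. They are
  also the displacement in the plane when the link is followed and then a \<open>B\<close>-link is
  descended.\<close>

fun step_exponents :: "link_kind \<Rightarrow> int \<times> int" where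
  "step_exponents LinkA = (1, 0)"
| "step_exponents LinkB = (0, 0)"
| "step_exponents LinkC = (1, 1)"
| "step_exponents LinkD = (0, 1)"

fun below :: "int \<Rightarrow> vertex \<Rightarrow> vertex" where
  "below m (\<xi>, \<eta>) = (\<xi>, (\<eta> - 1) mod m)"

definition white_step :: "int \<Rightarrow> int \<Rightarrow> link_kind \<Rightarrow> vertex \<Rightarrow> vertex" where
  "white_step l m k z = below m (link_target l m k z)"

text \<open>The plane \<open>\<int>\<^sup>2\<close> covers the white vertices; \<open>cycle_exponents\<close> is a section of the covering.\<close>

fun torus_point :: "int \<Rightarrow> int \<Rightarrow> int \<times> int \<Rightarrow> vertex" where
  "torus_point l m (i, j) = ((i - j) mod l, (- (i + j)) mod m)"

text \<open>The deck translations of the covering \<open>torus_point\<close>.\<close>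

definition period :: "int \<Rightarrow> int \<Rightarrow> int \<times> int \<Rightarrow> bool" where
  "period l m v \<longleftrightarrow> l dvd fst v - snd v \<and> m dvd fst v + snd v"

section \<open>The covering of the white vertices by the plane\<close>

locale even_torus =
  fixes l m :: int
  assumes l_pos: "l > 0" and l_even: "even l" and m_pos: "m > 0" and m_even: "even m"
begin

abbreviation whites :: "vertex set" where
  "whites \<equiv> set (white_vertices l m)"

lemma white_iff: "(\<xi>, \<eta>) \<in> whites \<longleftrightarrow> 0 \<le> \<xi> \<and> \<xi> < l \<and> 0 \<le> \<eta> \<and> \<eta> < m \<and> even (\<xi> + \<eta>)"
  by (auto simp: white_vertices_def)

lemma black_iff:
  "(\<xi>, \<eta>) \<in> set (black_vertices l m) \<longleftrightarrow> 0 \<le> \<xi> \<and> \<xi> < l \<and> 0 \<le> \<eta> \<and> \<eta> < m \<and> odd (\<xi> + \<eta>)"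
  by (auto simp: black_vertices_def)

lemma even_mod_l: "even (a mod l) \<longleftrightarrow> even a"
  using l_even by (rule dvd_mod_iff)

lemma even_mod_m: "even (a mod m) \<longleftrightarrow> even a"
  using m_even by (rule dvd_mod_iff)

lemma torus_point_white: "torus_point l m v \<in> whites"
  using l_pos m_pos by (cases v) (auto simp: white_iff even_mod_l even_mod_m)

lemma torus_point_cycle_exponents:
  assumes "z \<in> whites"
  shows "torus_point l m (cycle_exponents z) = z"
proof -
  obtain \<xi> \<eta> where z: "z = (\<xi>, \<eta>)" by force
  obtain r where "\<eta> = 2 * r - \<xi>"
    using assms z by (metis white_iff add_diff_cancel_left' evenE)
  then have "cycle_exponents z = (\<xi> - r, - r)" using z by simp
  then show ?thesis using assms z \<open>\<eta> = 2 * r - \<xi>\<close> by (simp add: white_iff)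
qed

lemma torus_point_eq_iff: "torus_point l m v = torus_point l m w \<longleftrightarrow> period l m (v - w)"
proof -
  have "(- (i + j)) mod m = (- (i' + j')) mod m \<longleftrightarrow> m dvd (i - i') + (j - j')" for i j i' j'
    using mod_eq_dvd_iff[of "- (i + j)" m "- (i' + j')"] dvd_minus_iff[of m "(i - i') + (j - j')"]
    by (simp add: algebra_simps)
  moreover have "(i - j) mod l = (i' - j') mod l \<longleftrightarrow> l dvd (i - i') - (j - j')" for i j i' j'
    using mod_eq_dvd_iff[of "i - j" l "i' - j'"] by (simp add: algebra_simps)
  ultimately show ?thesis by (cases v; cases w) (simp add: period_def)
qed

lemma torus_point_add:
  "torus_point l m v = torus_point l m w \<Longrightarrow> torus_point l m (v + u) = torus_point l m (w + u)"
  by (simp add: torus_point_eq_iff)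

text \<open>The covering is chosen to turn white steps into translations. For instance, an
  \<open>A\<close>-link and a descent change \<open>(\<xi>, \<eta>)\<close> to
  \<open>(\<xi> + 1, \<eta> - 1)\<close>, which is the effect of raising \<open>i\<close> by
  one.\<close>

lemma white_step_torus_point:
  "white_step l m k (torus_point l m v) = torus_point l m (v + step_exponents k)"
  by (cases v; cases k) (simp_all add: white_step_def mod_simps algebra_simps)

lemma white_step_white: "z \<in> whites \<Longrightarrow> white_step l m k z \<in> whites"
  using white_step_torus_point[of k "cycle_exponents z"] torus_point_white
  by (simp add: torus_point_cycle_exponents)

text \<open>Translations of the plane permute the white vertices, so a sum over a fundamental domain
  does not depend on its position.\<close>

lemma sum_shift_whites:
  "(\<Sum>z\<in>whites. g (torus_point l m (cycle_exponents z + v))) = (\<Sum>z\<in>whites. g z)"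
proof (rule sum.reindex_bij_witness[where j = "\<lambda>z. torus_point l m (cycle_exponents z + v)"
      and i = "\<lambda>z. torus_point l m (cycle_exponents z - v)"])
  fix z assume z: "z \<in> whites"
  have "torus_point l m (cycle_exponents (torus_point l m (cycle_exponents z + u)) - u) = z" for u
    using torus_point_add[of "cycle_exponents (torus_point l m (cycle_exponents z + u))"
        "cycle_exponents z + u" "- u"] z
    by (simp add: torus_point_cycle_exponents torus_point_white)
  from this[of v] this[of "- v"]
  show "torus_point l m (cycle_exponents (torus_point l m (cycle_exponents z + v)) - v) = z"
    "torus_point l m (cycle_exponents (torus_point l m (cycle_exponents z - v)) + v) = z"
    by simp_all
qed (simp_all add: torus_point_white)

abbreviation blacks :: "vertex set" where
  "blacks \<equiv> set (black_vertices l m)"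

lemma link_target_black: "z \<in> whites \<Longrightarrow> link_target l m k z \<in> blacks"
  using l_pos m_pos
  by (case_tac z, case_tac k) (auto simp: white_iff black_iff even_mod_l even_mod_m)

lemma inj_on_below: "inj_on (below m) blacks"
proof (rule inj_on_inverseI[where g = "\<lambda>(\<xi>, \<eta>). (\<xi>, (\<eta> + 1) mod m)"])
  fix z assume "z \<in> blacks"
  then show "(\<lambda>(\<xi>, \<eta>). (\<xi>, (\<eta> + 1) mod m)) (below m z) = z"
    by (case_tac z) (simp add: black_iff mod_simps)
qed

lemma below_white: "w \<in> blacks \<Longrightarrow> below m w \<in> whites"
  using m_pos by (case_tac w) (auto simp: white_iff black_iff even_mod_m)

lemma below_target_LinkB: "z \<in> whites \<Longrightarrow> below m (link_target l m LinkB z) = z"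
  by (case_tac z) (simp add: white_iff mod_simps)

lemma below_image: "below m ` blacks = whites"
proof (intro subset_antisym subsetI)
  fix z assume "z \<in> whites"
  then show "z \<in> below m ` blacks"
    using below_target_LinkB link_target_black by (metis image_eqI)
qed (blast intro: below_white)

lemma card_blacks: "card blacks = card whites"
  using card_image[OF inj_on_below] below_image by simp

lemma double_card_whites: "2 * int (card whites) = l * m"
proof -
  have "whites \<union> blacks = {0..<l} \<times> {0..<m}" "whites \<inter> blacks = {}"
    by (auto simp: white_iff black_iff)
  then have "card ({0..<l} \<times> {0..<m}) = card whites + card whites"
    using card_blacks by (metis card_Un_disjoint List.finite_set)
  then have "int (card whites + card whites) = l * m"
    using l_pos m_pos by (metis card_cartesian_product card_atLeastLessThan_int diff_zero
        int_nat_eq less_imp_le of_nat_mult)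
  then show ?thesis by simp
qed

end

text \<open>A choice of one link at every white vertex. As \<open>below\<close> is injective on
  black vertices, injectivity says that no black vertex is hit twice, so the choice is a perfect
  matching.\<close>

locale torus_matching = even_torus +
  fixes \<kappa> :: "vertex \<Rightarrow> link_kind"
  assumes inj_step: "inj_on (\<lambda>z. white_step l m (\<kappa> z) z) (set (white_vertices l m))"
begin

section \<open>The permutation of a matching and its lift to the plane\<close>

definition torus_perm :: "vertex \<Rightarrow> vertex" where
  "torus_perm = restrict_id (\<lambda>z. white_step l m (\<kappa> z) z) whites"

definition plane_perm :: "int \<times> int \<Rightarrow> int \<times> int" where
  "plane_perm v = v + step_exponents (\<kappa> (torus_point l m v))"

definition uses :: "link_kind \<Rightarrow> int" where
  "uses k = int (card {z \<in> whites. \<kappa> z = k})"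

lemma torus_perm_white: "z \<in> whites \<Longrightarrow> torus_perm z = white_step l m (\<kappa> z) z"
  by (simp add: torus_perm_def)

lemma torus_perm_permutes: "torus_perm permutes whites"
proof (rule bij_imp_permutes)
  have "(\<lambda>z. white_step l m (\<kappa> z) z) ` whites = whites"
    using white_step_white by (intro endo_inj_surj inj_step) auto
  with inj_step have "bij_betw (\<lambda>z. white_step l m (\<kappa> z) z) whites whites"
    by (simp add: bij_betw_def)
  then show "bij_betw torus_perm whites whites"
    unfolding torus_perm_def by (rule bij_betw_restrict_id) simp
qed (simp add: torus_perm_def)

lemma torus_point_plane_perm: "torus_point l m (plane_perm v) = torus_perm (torus_point l m v)"
  by (simp add: plane_perm_def torus_perm_white torus_point_white white_step_torus_point)

lemma torus_point_plane_perm_funpow: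
  "torus_point l m ((plane_perm ^^ n) v) = (torus_perm ^^ n) (torus_point l m v)"
  by (induction n) (simp_all add: torus_point_plane_perm)

lemma plane_perm_period: "period l m u \<Longrightarrow> plane_perm (v + u) = plane_perm v + u"
  using torus_point_eq_iff[of "v + u" v] by (simp add: plane_perm_def)

text \<open>Points with equal images lie over the same white vertex and so make the same step. For
  surjectivity, a preimage is taken on the torus and its lift is corrected by a period.\<close>

lemma bij_plane_perm: "bij plane_perm"
proof (rule bijI)
  show "inj plane_perm"
  proof (rule injI)
    fix v w assume eq: "plane_perm v = plane_perm w"
    then have "torus_perm (torus_point l m v) = torus_perm (torus_point l m w)"
      by (metis torus_point_plane_perm)
    then have "torus_point l m v = torus_point l m w"
      using torus_perm_permutes by (metis permutes_inj injD)
    with eq show "v = w" by (simp add: plane_perm_def)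
  qed
  show "surj plane_perm"
    unfolding surj_def
  proof
    fix w
    obtain z where z: "z \<in> whites" "torus_perm z = torus_point l m w"
      using torus_perm_permutes torus_point_white[of w] by (metis imageE permutes_image)
    define v where "v = cycle_exponents z"
    have "torus_point l m w = torus_point l m (plane_perm v)"
      using z by (simp add: torus_point_plane_perm v_def torus_point_cycle_exponents)
    then have "period l m (w - plane_perm v)" by (simp add: torus_point_eq_iff)
    from plane_perm_period[OF this, of v] show "\<exists>x. w = plane_perm x"
      by (metis add_diff_cancel_left' add_diff_eq)
  qed
qed

sublocale monotone_step_bijection plane_perm
proof
  fix i j
  show "plane_perm (i, j) \<in> {(i, j), (i + 1, j), (i, j + 1), (i + 1, j + 1)}"
    by (cases "\<kappa> (torus_point l m (i, j))") (simp_all add: plane_perm_def)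
qed (rule bij_plane_perm)

lemma plane_perm_eq_iff:
  "plane_perm v = v + step_exponents k \<longleftrightarrow> \<kappa> (torus_point l m v) = k"
  by (cases "\<kappa> (torus_point l m v)"; cases k) (simp_all add: plane_perm_def prod_eq_iff)

lemma plane_perm_moves: "plane_perm v \<noteq> v \<longleftrightarrow> \<kappa> (torus_point l m v) \<noteq> LinkB"
  using plane_perm_eq_iff[of v LinkB] by (simp flip: zero_prod_def)

lemma enters_up_eq:
  "enters_up i j = of_bool (\<kappa> (torus_point l m ((i, j) - (0, 1))) = LinkD)
     + of_bool (\<kappa> (torus_point l m ((i, j) - (1, 1))) = LinkC)"
  using plane_perm_eq_iff[of "(i, j - 1)" LinkD] plane_perm_eq_iff[of "(i - 1, j - 1)" LinkC]
  by (simp add: enters_up_def)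

lemma leaves_right_eq:
  "leaves_right i j = of_bool (\<kappa> (torus_point l m (i, j)) = LinkA)
     + of_bool (\<kappa> (torus_point l m (i, j)) = LinkC)"
  using plane_perm_eq_iff[of "(i, j)" LinkA] plane_perm_eq_iff[of "(i, j)" LinkC]
  by (simp add: leaves_right_def)

lemma sum_kind:
  "(\<Sum>z\<in>whites. of_bool (\<kappa> (torus_point l m (cycle_exponents z + v)) = k)) = uses k"
  using sum_shift_whites[of "\<lambda>z. of_bool (\<kappa> z = k) :: int" v]
  by (simp add: uses_def Int_def)

text \<open>Modulo \<open>l\<close> and \<open>m\<close>, each step is the difference of the
  coordinates of \<open>torus_perm z\<close> and \<open>z\<close>. These differences sum to zero
  because \<open>torus_perm\<close> is a permutation.\<close>

lemma total_exponents_period: "period l m (uses LinkA + uses LinkC, uses LinkC + uses LinkD)"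
proof -
  have uses_sum: "uses k = (\<Sum>z\<in>whites. of_bool (\<kappa> z = k))" for k
    by (simp add: uses_def Int_def)
  have fst_step: "l dvd (fst (torus_perm z) - fst z) - (of_bool (\<kappa> z = LinkA) - of_bool (\<kappa> z = LinkD))"
    and snd_step: "m dvd (snd (torus_perm z) - snd z)
      + (of_bool (\<kappa> z = LinkA) + 2 * of_bool (\<kappa> z = LinkC) + of_bool (\<kappa> z = LinkD))"
    if "z \<in> whites" for z
  proof -
    \<comment> \<open>In torus coordinates the step is \<open>(e, - f)\<close>. A
      \<open>C\<close>-link and the descent both lower \<open>\<eta>\<close>, hence the factor
      2.\<close>
    define e f :: int where "e = of_bool (\<kappa> z = LinkA) - of_bool (\<kappa> z = LinkD)"
      and "f = of_bool (\<kappa> z = LinkA) + 2 * of_bool (\<kappa> z = LinkC) + of_bool (\<kappa> z = LinkD)"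
    have tp: "torus_perm z = ((fst z + e) mod l, (snd z + - f) mod m)"
      using that unfolding e_def f_def
      by (case_tac z, case_tac "\<kappa> z") (simp_all add: torus_perm_white white_step_def white_iff mod_simps)
    have dvd: "k dvd (x + y) mod k - x - y" for k x y :: int
      using mod_eq_dvd_iff[of "(x + y) mod k" k "x + y"] by (simp add: algebra_simps)
    show "l dvd (fst (torus_perm z) - fst z) - (of_bool (\<kappa> z = LinkA) - of_bool (\<kappa> z = LinkD))"
      "m dvd (snd (torus_perm z) - snd z)
        + (of_bool (\<kappa> z = LinkA) + 2 * of_bool (\<kappa> z = LinkC) + of_bool (\<kappa> z = LinkD))"
      unfolding e_def[symmetric] f_def[symmetric] tp
      using dvd[of l "fst z" e] dvd[of m "snd z" "- f"] by simp_all
  qed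
  have inv: "(\<Sum>z\<in>whites. g (torus_perm z)) = (\<Sum>z\<in>whites. g z)" for g :: "vertex \<Rightarrow> int"
    using sum.permute[OF torus_perm_permutes, of g] by (simp add: o_def)
  have "l dvd (\<Sum>z\<in>whites. (fst (torus_perm z) - fst z)
      - (of_bool (\<kappa> z = LinkA) - of_bool (\<kappa> z = LinkD)))"
    using fst_step by (intro dvd_sum)
  also have "\<dots> = uses LinkD - uses LinkA"
    by (simp add: sum_subtractf inv[of fst] uses_sum)
  finally have "l dvd uses LinkA - uses LinkD" by (simp add: dvd_diff_commute)
  moreover have "m dvd (\<Sum>z\<in>whites. (snd (torus_perm z) - snd z)
      + (of_bool (\<kappa> z = LinkA) + 2 * of_bool (\<kappa> z = LinkC) + of_bool (\<kappa> z = LinkD)))"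
    using snd_step by (intro dvd_sum)
  then have "m dvd uses LinkA + 2 * uses LinkC + uses LinkD"
    by (simp add: sum_subtractf sum.distrib inv[of snd] uses_sum flip: sum_distrib_left)
  ultimately show ?thesis by (simp add: period_def algebra_simps)
qed

section \<open>Height increments along periods and the sign of the permutation\<close>

abbreviation total_right :: int where "total_right \<equiv> uses LinkA + uses LinkC"
abbreviation total_up :: int where "total_up \<equiv> uses LinkC + uses LinkD"

text \<open>Double counting of \<open>h\<close>-increments over a fundamental domain: a unit move
  right adds the whole upward flow, a unit move up subtracts the whole rightward flow, and along a
  period all summands agree. The right side is the intersection number with the total class.\<close>

lemma height_flux:
  assumes "step_bijection_height plane_perm h" and per: "period l m (a, b)"
  shows "int (card whites) * (h a b - h 0 0) = a * total_up - b * total_right"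
proof -
  interpret step_bijection_height plane_perm h by fact
  define x y where "x = (\<lambda>z. fst (cycle_exponents z))" and "y = (\<lambda>z. snd (cycle_exponents z))"
  have xy: "cycle_exponents z = (x z, y z)" for z by (simp add: x_def y_def)
  \<comment> \<open>\<open>F\<close> also makes sense for translations that are not periods, which
    permits induction over unit moves.\<close>
  define F where "F = (\<lambda>a b. \<Sum>z\<in>whites. h (x z + a) (y z + b) - h (x z) (y z))"
  have up: "(\<Sum>z\<in>whites. enters_up (x z + a) (y z + b)) = total_up" for a b
  proof -
    have "(\<Sum>z\<in>whites. enters_up (x z + a) (y z + b)) =
      (\<Sum>z\<in>whites. of_bool (\<kappa> (torus_point l m (cycle_exponents z + (a, b - 1))) = LinkD)) +
      (\<Sum>z\<in>whites. of_bool (\<kappa> (torus_point l m (cycle_exponents z + (a - 1, b - 1))) = LinkC))"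
      by (simp add: enters_up_eq xy sum.distrib algebra_simps del: torus_point.simps)
    then show ?thesis by (simp only: sum_kind)
  qed
  have right: "(\<Sum>z\<in>whites. leaves_right (x z + a) (y z + b)) = total_right" for a b
  proof -
    have "(\<Sum>z\<in>whites. leaves_right (x z + a) (y z + b)) =
      (\<Sum>z\<in>whites. of_bool (\<kappa> (torus_point l m (cycle_exponents z + (a, b))) = LinkA)) +
      (\<Sum>z\<in>whites. of_bool (\<kappa> (torus_point l m (cycle_exponents z + (a, b))) = LinkC))"
      by (simp add: leaves_right_eq xy sum.distrib del: torus_point.simps)
    then show ?thesis by (simp only: sum_kind)
  qed
  have F_right: "F (a + 1) b = F a b + total_up" for a b
    using h_right[of "x z + a" "y z + b" for z] up[of "a + 1" b]
    by (simp add: F_def sum.distrib sum_subtractf algebra_simps)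
  have F_up: "F a (b + 1) = F a b - total_right" for a b
  proof -
    have "h (x z + a) (y z + (b + 1)) = h (x z + a) (y z + b) - leaves_right (x z + a) (y z + b)" for z
      by (metis add.assoc h_up)
    then show ?thesis by (simp add: F_def sum_subtractf right)
  qed
  have F_row: "F a 0 = a * total_up" for a
  proof (induction a rule: int_induct[where k = 0])
    case base
    then show ?case by (simp add: F_def)
  next
    case (step1 a)
    then show ?case using F_right[of a 0] by (simp add: algebra_simps)
  next
    case (step2 a)
    then show ?case using F_right[of "a - 1" 0] by (simp add: algebra_simps)
  qed
  have "F a b = F a 0 - b * total_right" for a b
  proof (induction b rule: int_induct[where k = 0])
    case (step1 b)
    then show ?case using F_up[of a b] by (simp add: algebra_simps)
  next
    case (step2 b)
    then show ?case using F_up[of a "b - 1"] by (simp add: algebra_simps)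
  qed simp
  from this[of a b] F_row[of a] have "F a b = a * total_up - b * total_right" by simp
  moreover have "h (i + a) (j + b) - h i j = h a b - h 0 0" for i j
    using plane_perm_period[OF per, of "(i, j)" for i j] by (intro period_shifts_height) simp
  then have "F a b = int (card whites) * (h a b - h 0 0)"
    by (simp add: F_def)
  ultimately show ?thesis by simp
qed

text \<open>The cycles of \<open>torus_perm\<close> through links other than \<open>B\<close>-links correspond to the heights
  modulo the increments of the height along the periods.\<close>

lemma sign_torus_perm:
  assumes per: "period l m (a1, b1)" "period l m (a2, b2)"
    and span: "\<And>v. period l m v \<Longrightarrow> \<exists>r s. v = (r * a1 + s * a2, r * b1 + s * b2)"
    and index: "\<bar>a1 * b2 - b1 * a2\<bar> = int (card whites)"
    and total: "total_right = r * a1 + s * a2" "total_up = r * b1 + s * b2"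
  shows "sign torus_perm * (-1) ^ card {z \<in> whites. \<kappa> z \<noteq> LinkB} =
      (if even r \<and> even s then 1 else -1)"
proof -
  define N where "N = int (card whites)"
  have N_pos: "N > 0" using double_card_whites mult_pos_pos[OF l_pos m_pos] unfolding N_def by linarith
  define M where "M = {z \<in> whites. \<kappa> z \<noteq> LinkB}"
  obtain h where h: "step_bijection_height plane_perm h" by (rule height_exists)
  interpret step_bijection_height plane_perm h by fact
  define chi where "chi = (\<lambda>a b. h a b - h 0 0)"
  have chi: "N * chi a b = a * total_up - b * total_right" if "period l m (a, b)" for a b
    using height_flux[OF h that] by (simp add: chi_def N_def)
  \<comment> \<open>The determinant of the period basis; up to sign it is \<open>N\<close>. Hence
    \<open>N\<close> cancels below, and the increments along the two basis periods are
    \<open>s\<close> and \<open>r\<close> up to sign.\<close>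
  define D where "D = a1 * b2 - b1 * a2"
  have absD: "\<bar>D\<bar> = N" using index by (simp add: D_def N_def)
  have "N * chi a1 b1 = s * D" "N * chi a2 b2 = - (r * D)"
    using chi[OF per(1)] chi[OF per(2)] by (simp_all add: total D_def algebra_simps)
  then have "\<bar>N * chi a1 b1\<bar> = \<bar>s * D\<bar>" "\<bar>N * chi a2 b2\<bar> = \<bar>- (r * D)\<bar>"
    by (simp_all only:)
  with N_pos have abs_chi: "\<bar>chi a1 b1\<bar> = \<bar>s\<bar>" "\<bar>chi a2 b2\<bar> = \<bar>r\<bar>"
    by (simp_all add: abs_mult absD)
  \<comment> \<open>The nonnegative generator of the group of increments, which is the gcd of
    \<open>r\<close> and \<open>s\<close>.\<close>
  define n where "n = gcd (chi a1 b1) (chi a2 b2)"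
  have n_even: "even n \<longleftrightarrow> even r \<and> even s"
    using abs_chi by (metis dvd_abs_iff gcd_greatest_iff n_def)
  have chi_shift: "h (i + a) (j + b) = h i j + chi a b" if "period l m (a, b)" for a b i j
  proof -
    have "plane_perm (i + a, j + b) = plane_perm (i, j) + (a, b)" for i j
      using plane_perm_period[OF that, of "(i, j)"] by simp
    then show ?thesis using period_shifts_height[of a b i j] by (simp add: chi_def)
  qed
  have per_comb: "period l m (t * a1 + u * a2, t * b1 + u * b2)" for t u
  proof -
    have "t * a1 + u * a2 - (t * b1 + u * b2) = t * (a1 - b1) + u * (a2 - b2)"
      "t * a1 + u * a2 + (t * b1 + u * b2) = t * (a1 + b1) + u * (a2 + b2)"
      by (simp_all add: algebra_simps)
    with per show ?thesis by (simp add: period_def)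
  qed
  have chi_comb: "chi (t * a1 + u * a2) (t * b1 + u * b2) = t * chi a1 b1 + u * chi a2 b2" for t u
  proof -
    have "N * chi (t * a1 + u * a2) (t * b1 + u * b2)
        = t * (a1 * total_up - b1 * total_right) + u * (a2 * total_up - b2 * total_right)"
      unfolding chi[OF per_comb] by (simp add: algebra_simps)
    also have "\<dots> = N * (t * chi a1 b1 + u * chi a2 b2)"
      unfolding chi[OF per(1), symmetric] chi[OF per(2), symmetric] by (simp add: algebra_simps)
    finally show ?thesis using N_pos by simp
  qed
  have n_dvd: "n dvd chi a b" if ab: "period l m (a, b)" for a b
  proof -
    obtain t u where "(a, b) = (t * a1 + u * a2, t * b1 + u * b2)" using span[OF ab] by blast
    then show ?thesis using chi_comb[of t u] by (simp add: n_def)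
  qed
  have chi_onto: "\<exists>a b. period l m (a, b) \<and> chi a b = c" if "n dvd c" for c
  proof -
    obtain u v where uv: "u * chi a1 b1 + v * chi a2 b2 = n"
      using bezout_int unfolding n_def by blast
    obtain k where k: "c = n * k" using \<open>n dvd c\<close> by blast
    have "chi (u * k * a1 + v * k * a2) (u * k * b1 + v * k * b2) = c"
      unfolding chi_comb k uv[symmetric] by (simp add: algebra_simps)
    with per_comb show ?thesis by blast
  qed
  \<comment> \<open>Modulo \<open>n\<close> the height does not depend on the chosen lift. If
    \<open>n = 0\<close>, \<open>mod\<close> leaves the height unchanged; by the case distinction
    below, \<open>M\<close> is then empty.\<close>
  define lab where "lab = (\<lambda>z. h (fst (cycle_exponents z)) (snd (cycle_exponents z)) mod n)"
  have lab_point: "lab (torus_point l m (i, j)) = h i j mod n" for i j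
  proof -
    obtain i' j' where ij: "cycle_exponents (torus_point l m (i, j)) = (i', j')" by force
    have "torus_point l m (i', j') = torus_point l m (i, j)"
      unfolding ij[symmetric] by (rule torus_point_cycle_exponents[OF torus_point_white])
    then have "period l m (i' - i, j' - j)" by (simp only: torus_point_eq_iff diff_Pair)
    with n_dvd chi_shift[of "i' - i" "j' - j" i j] have "n dvd h i' j' - h i j" by simp
    then show ?thesis using ij by (simp add: lab_def mod_eq_dvd_iff)
  qed
  have lift: "\<exists>i j. z = torus_point l m (i, j)" if "z \<in> whites" for z
    using torus_point_cycle_exponents[OF that] by (metis surj_pair)
  have M_white: "z \<in> M \<Longrightarrow> z \<in> whites" for z by (simp add: M_def)
  have M_iff: "torus_point l m v \<in> M \<longleftrightarrow> plane_perm v \<noteq> v" for v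
    by (simp add: M_def torus_point_white plane_perm_moves)
  \<comment> \<open>The vertices with \<open>B\<close>-links are exactly the fixed points, so only
    the nontrivial cycles remain on \<open>M\<close>.\<close>
  have permM: "torus_perm permutes M"
  proof (rule permutes_superset[OF torus_perm_permutes])
    fix z assume "z \<in> whites - M"
    moreover obtain i j where "z = torus_point l m (i, j)" using lift calculation by blast
    ultimately show "torus_perm z = z"
      using M_iff[of "(i, j)"] torus_point_plane_perm[of "(i, j)"] by simp
  qed
  have finM: "finite M" by (simp add: M_def)
  have "sign torus_perm = (-1) ^ (card M + card (lab ` M))"
  proof (rule sign_eq_card_labels[OF finM permM])
    fix z assume "z \<in> M"
    then obtain i j where z: "z = torus_point l m (i, j)" using lift M_white by blast
    obtain i' j' where ij: "plane_perm (i, j) = (i', j')" by force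
    show "lab (torus_perm z) = lab z"
      using torus_point_plane_perm[of "(i, j)"] h_invariant[OF ij] lab_point[of i j] lab_point[of i' j']
      by (simp only: z ij)
  next
    fix z w assume zw: "z \<in> M" "w \<in> M" "lab z = lab w"
    obtain i j where z: "z = torus_point l m (i, j)" using lift M_white zw by blast
    obtain i' j' where w: "w = torus_point l m (i', j')" using lift M_white zw by blast
    have "n dvd h i' j' - h i j"
      using zw(3) lab_point[of i j] lab_point[of i' j'] z w by (metis mod_eq_dvd_iff)
    \<comment> \<open>Labels agree only modulo \<open>n\<close>; a period moves the lift of
      \<open>z\<close> to exactly the height of the lift of \<open>w\<close>.\<close>
    then obtain a b where ab: "period l m (a, b)" "chi a b = h i' j' - h i j"
      using chi_onto by blast
    have z': "z = torus_point l m (i + a, j + b)"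
      using ab(1) torus_point_eq_iff[of "(i + a, j + b)" "(i, j)"] z by simp
    have moved: "plane_perm (i + a, j + b) \<noteq> (i + a, j + b)" "plane_perm (i', j') \<noteq> (i', j')"
      using zw M_iff[of "(i + a, j + b)"] M_iff[of "(i', j')"] z' w by auto
    have "h (i + a) (j + b) = h i' j'" using chi_shift[OF ab(1)] ab(2) by simp
    then have "\<exists>k. (plane_perm ^^ k) (i + a, j + b) = (i', j')
        \<or> (plane_perm ^^ k) (i', j') = (i + a, j + b)"
      using same_height_same_orbit[OF moved] same_height_same_orbit[OF moved(2,1)]
      by (cases "i + a + (j + b) \<le> i' + j'") auto
    then show "\<exists>k. (torus_perm ^^ k) z = w \<or> (torus_perm ^^ k) w = z"
      using torus_point_plane_perm_funpow z' w by metis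
  qed
  moreover have "(-1) ^ card (lab ` M) = (if even r \<and> even s then 1 else -1 :: int)"
  proof (cases "M = {}")
    case True
    \<comment> \<open>With \<open>B\<close>-links only, both totals vanish; as \<open>D\<close> is
      nonzero, \<open>r = s = 0\<close>, and there are no labels.\<close>
    then have "uses k = 0" if "k \<noteq> LinkB" for k
      using that by (auto simp: uses_def M_def)
    then have "s * D = 0" "r * D = 0"
      using chi[OF per(1)] chi[OF per(2)] \<open>N * chi a1 b1 = s * D\<close> \<open>N * chi a2 b2 = - (r * D)\<close>
      by simp_all
    then show ?thesis using absD N_pos True by auto
  next
    case False
    \<comment> \<open>\<open>(e, - e)\<close> is a period along the antidiagonal: the difference of
      its entries is \<open>l * m\<close> and their sum is 0.\<close>
    define e where "e = l * m div 2"
    have e: "e > 0" "period l m (e, - e)"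
      using l_pos m_pos l_even m_even
      by (auto simp: e_def period_def zero_less_mult_iff elim!: evenE)
    have pe: "plane_perm (i + e, j + - e) = plane_perm (i, j) + (e, - e)" for i j
      using plane_perm_period[OF e(2), of "(i, j)"] by simp
    obtain i0 j0 where moved: "plane_perm (i0, j0) \<noteq> (i0, j0)"
    proof -
      obtain z where "z \<in> M" using False by blast
      moreover from this obtain i j where "z = torus_point l m (i, j)"
        using lift M_white by blast
      ultimately show ?thesis using M_iff[of "(i, j)"] that by blast
    qed
    have "chi e (- e) > 0"
      using antidiagonal_period_pos[OF pe e(1) moved] by (simp add: chi_def)
    with n_dvd[OF e(2)] have "n \<noteq> 0" by auto
    then have n_pos: "n > 0" by (simp add: n_def)
    \<comment> \<open>All residues occur since every height is attained at a moved point. So the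
      number of cycles is \<open>n\<close>, whose parity is given by \<open>n_even\<close>.\<close>
    have "lab ` M = {0..<n}"
    proof (intro subset_antisym subsetI)
      fix c assume "c \<in> lab ` M"
      then show "c \<in> {0..<n}" using n_pos by (auto simp: lab_def)
    next
      fix c assume c: "c \<in> {0..<n}"
      obtain i j where "plane_perm (i, j) \<noteq> (i, j)" "h i j = c"
        using every_height_moved[OF pe e(1) moved] by blast
      then have "torus_point l m (i, j) \<in> M" "lab (torus_point l m (i, j)) = c"
        using M_iff[of "(i, j)"] lab_point[of i j] c by simp_all
      then show "c \<in> lab ` M" by blast
    qed
    then show ?thesis
      using n_pos n_even by (simp add: even_nat_iff)
  qed
  ultimately show ?thesis
    by (simp add: M_def power_add flip: power_mult_distrib)
qed

end

section \<open>Substitution of monomials\<close>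

definition laurent_exponents :: "int \<times> int \<Rightarrow> int \<times> int \<Rightarrow> int \<times> int \<Rightarrow> int \<times> int" where
  "laurent_exponents e e' k = (fst k * fst e + snd k * fst e', fst k * snd e + snd k * snd e')"

text \<open>Cramer's rule. Injectivity expresses the algebraic independence of the monomials
  \<open>x\<close> and \<open>y\<close>.\<close>

lemma inj_laurent_exponents:
  assumes "fst e * snd e' - snd e * fst e' \<noteq> 0"
  shows "inj (laurent_exponents e e')"
proof (rule injI)
  fix k k' assume "laurent_exponents e e' k = laurent_exponents e e' k'"
  then have eq: "(fst k - fst k') * fst e + (snd k - snd k') * fst e' = 0"
    "(fst k - fst k') * snd e + (snd k - snd k') * snd e' = 0"
    by (simp_all add: laurent_exponents_def algebra_simps)
  have "(fst k - fst k') * (fst e * snd e' - snd e * fst e') =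
      ((fst k - fst k') * fst e + (snd k - snd k') * fst e') * snd e'
      - ((fst k - fst k') * snd e + (snd k - snd k') * snd e') * fst e'"
    "(snd k - snd k') * (fst e * snd e' - snd e * fst e') =
      ((fst k - fst k') * snd e + (snd k - snd k') * snd e') * fst e
      - ((fst k - fst k') * fst e + (snd k - snd k') * fst e') * snd e"
    by (simp_all add: algebra_simps)
  then show "k = k'" unfolding eq using assms by (simp add: prod_eq_iff)
qed

lemma lookup_lsubst:
  "Poly_Mapping.lookup (lsubst \<alpha> e \<beta> e' g) v =
     (\<Sum>k\<in>Poly_Mapping.keys g. if laurent_exponents e e' k = v
        then Poly_Mapping.lookup g k * \<alpha> powi fst k * \<beta> powi snd k else 0)"
  by (auto simp: lsubst_def lookup_sum lookup_single laurent_exponents_def when_def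
      split_beta intro!: sum.cong)

lemma lookup_lsubst_inj:
  assumes "inj (laurent_exponents e e')"
  shows "Poly_Mapping.lookup (lsubst \<alpha> e \<beta> e' g) (laurent_exponents e e' k) =
     Poly_Mapping.lookup g k * \<alpha> powi fst k * \<beta> powi snd k"
proof -
  have "Poly_Mapping.lookup (lsubst \<alpha> e \<beta> e' g) (laurent_exponents e e' k) =
     (\<Sum>k'\<in>Poly_Mapping.keys g. if k' = k
        then Poly_Mapping.lookup g k' * \<alpha> powi fst k' * \<beta> powi snd k' else 0)"
    unfolding lookup_lsubst using assms by (intro sum.cong) (auto dest: injD)
  then show ?thesis by (simp add: in_keys_iff)
qed

lemma lookup_lsubst_outside:
  "v \<notin> range (laurent_exponents e e') \<Longrightarrow> Poly_Mapping.lookup (lsubst \<alpha> e \<beta> e' g) v = 0"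
  by (auto simp: lookup_lsubst intro!: sum.neutral)

lemma lookup_sign_change:
  "Poly_Mapping.lookup (sign_change \<epsilon> \<delta> g) k =
     Poly_Mapping.lookup g k * \<epsilon> powi fst k * \<delta> powi snd k"
proof -
  have "laurent_exponents (1, 0) (0, 1) = (\<lambda>k. k)" by (simp add: laurent_exponents_def fun_eq_iff)
  then show ?thesis
    unfolding sign_change_def using lookup_lsubst_inj[of "(1, 0)" "(0, 1)" \<epsilon> \<delta> g k] by simp
qed

lemma lookup_lconst_mult:
  "Poly_Mapping.lookup (lconst \<alpha> * g) k = \<alpha> * Poly_Mapping.lookup g k"
proof -
  have "lconst \<alpha> = Poly_Mapping.single 0 \<alpha>" by (simp add: lconst_def zero_prod_def)
  moreover have "Poly_Mapping.map ((*) \<alpha>) g = Poly_Mapping.single 0 \<alpha> * g"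
    by (rule mult_map_scale_conv_mult)
  ultimately have "lconst \<alpha> * g = Poly_Mapping.map ((*) \<alpha>) g" by simp
  then show ?thesis by (simp add: map.rep_eq when_def)
qed

lemma prod_single:
  fixes c :: "'a \<Rightarrow> 'b :: comm_semiring_1" and e :: "'a \<Rightarrow> 'c :: comm_monoid_add"
  assumes "finite A"
  shows "(\<Prod>z\<in>A. Poly_Mapping.single (e z) (c z)) = Poly_Mapping.single (\<Sum>z\<in>A. e z) (\<Prod>z\<in>A. c z)"
  using assms by (induction A rule: finite_induct) (simp_all add: mult_single)

text \<open>\<open>lsubst\<close> runs over the support of its argument, where terms of the sum may
  have cancelled, so the two sides are compared coefficient by coefficient.\<close>

lemma lsubst_sum_single:
  assumes "inj (laurent_exponents e e')" "finite K"
  shows "lsubst 1 e 1 e' (\<Sum>\<kappa>\<in>K. Poly_Mapping.single (k \<kappa>) (c \<kappa>)) =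
    (\<Sum>\<kappa>\<in>K. Poly_Mapping.single (laurent_exponents e e' (k \<kappa>)) (c \<kappa>))"
proof (rule poly_mapping_eqI)
  fix v
  show "Poly_Mapping.lookup (lsubst 1 e 1 e' (\<Sum>\<kappa>\<in>K. Poly_Mapping.single (k \<kappa>) (c \<kappa>))) v =
    Poly_Mapping.lookup (\<Sum>\<kappa>\<in>K. Poly_Mapping.single (laurent_exponents e e' (k \<kappa>)) (c \<kappa>)) v"
  proof (cases "v \<in> range (laurent_exponents e e')")
    case True
    then obtain j where v: "v = laurent_exponents e e' j" by blast
    show ?thesis
      unfolding v lookup_lsubst_inj[OF assms(1)]
      by (simp add: lookup_sum lookup_single when_def inj_eq[OF assms(1)])
  next
    case False
    then have "laurent_exponents e e' (k \<kappa>) \<noteq> v" for \<kappa> by blast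
    then show ?thesis
      unfolding lookup_lsubst_outside[OF False] by (simp add: lookup_sum lookup_single)
  qed
qed

lemma inj_lsubst:
  assumes "inj (laurent_exponents e e')"
  shows "inj (lsubst 1 e 1 e')"
proof (rule injI, rule poly_mapping_eqI)
  fix g g' k assume "lsubst 1 e 1 e' g = lsubst 1 e 1 e' g'"
  then show "Poly_Mapping.lookup g k = Poly_Mapping.lookup g' k"
    using lookup_lsubst_inj[OF assms, of 1 1 g k] lookup_lsubst_inj[OF assms, of 1 1 g' k] by simp
qed

definition parity_sign :: "int \<times> int \<Rightarrow> complex" where
  "parity_sign k = (if even (fst k) \<and> even (snd k) then 1 else -1)"

text \<open>For exponents \<open>i\<close> and \<open>j\<close>, the number
  \<open>(- 1 + (-1)^i + (-1)^j + (-1)^(i + j)) / 2\<close> is 1 if both are even and -1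
  otherwise.\<close>

lemma sign_change_average:
  "Poly_Mapping.lookup (lconst (1/2) *
      (- g + sign_change (-1) 1 g + sign_change 1 (-1) g + sign_change (-1) (-1) g)) k =
    parity_sign k * Poly_Mapping.lookup g k"
  by (simp add: lookup_lconst_mult lookup_add lookup_sign_change power_int_minus_left parity_sign_def
      del: uminus_add_conv_diff add_uminus_conv_diff)

section \<open>Expansion of the statistical sum and of the determinant\<close>

text \<open>The coefficient of a link weight after division by the weight \<open>- b z\<close> of
  the \<open>B\<close>-link at the same white vertex; this distributes the normalization over the
  vertices.\<close>

fun relative_coeff :: "(vertex \<Rightarrow> complex) \<Rightarrow> (vertex \<Rightarrow> complex) \<Rightarrow>
    (vertex \<Rightarrow> complex) \<Rightarrow> (vertex \<Rightarrow> complex) \<Rightarrow> link_kind \<Rightarrow> vertex \<Rightarrow> complex" where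
  "relative_coeff a b c d LinkA z = - (a z / b z)"
| "relative_coeff a b c d LinkB z = 1"
| "relative_coeff a b c d LinkC z = c z / b z"
| "relative_coeff a b c d LinkD z = d z / b z"

lemma link_weight_single:
  assumes "b z \<noteq> 0"
  shows "link_weight a b c d (k, z) * lconst (- inverse (b z)) =
    Poly_Mapping.single (step_exponents k) (relative_coeff a b c d k z)"
  using assms
  by (cases k) (simp_all add: var_u_def var_v_def lconst_def mult_single divide_inverse
      flip: single_uminus zero_prod_def)

lemma sum_pair: "(\<Sum>z\<in>A. (f z, g z)) = (sum f A, sum g A)"
  for f :: "'a \<Rightarrow> 'b :: comm_monoid_add" and g :: "'a \<Rightarrow> 'c :: comm_monoid_add"
  by (induction A rule: infinite_finite_induct) (simp_all add: zero_prod_def)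

lemma sum_nth_set:
  "distinct xs \<Longrightarrow> (\<Sum>j = 0..<length xs. f (xs ! j)) = (\<Sum>x\<in>set xs. f x)"
  by (rule sum.reindex_bij_betw[OF bij_betw_nth]) auto

text \<open>Any explicit right inverse \<open>B'\<close> certifies that \<open>mat_inverse\<close>
  succeeds; the result then cancels against \<open>B\<close>.\<close>

lemma mat_inverse_mult_eq:
  fixes B :: "'a :: field mat"
  assumes "B \<in> carrier_mat n n" "B' \<in> carrier_mat n n" "B * B' = 1\<^sub>m n" "G \<in> carrier_mat n n"
  shows "(G * B) * the (mat_inverse B) = G"
proof -
  have "B' * B = 1\<^sub>m n" using assms(1-3) by (rule mat_mult_left_right_inverse)
  with assms(1-3) have "B \<in> Units (ring_mat TYPE('a) n ())"
    unfolding Units_def ring_mat_simps by blast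
  then obtain X where X: "mat_inverse B = Some X"
    using mat_inverse(1)[OF assms(1), of "()"] by (cases "mat_inverse B") auto
  from mat_inverse(2)[OF assms(1) X] have BX: "B * X = 1\<^sub>m n" "X \<in> carrier_mat n n" by simp_all
  have "(G * B) * X = G * (B * X)" using assms(4,1) BX(2) by (rule assoc_mult_mat)
  then show ?thesis using X BX(1) assms(4) by simp
qed

section \<open>Dimer configurations as matchings\<close>

context even_torus
begin

text \<open>Extensional functions, so that each dimer configuration comes from one function
  only.\<close>

definition matchings :: "(vertex \<Rightarrow> link_kind) set" where
  "matchings = {\<kappa> \<in> whites \<rightarrow>\<^sub>E UNIV. inj_on (\<lambda>z. white_step l m (\<kappa> z) z) whites}"

lemma finite_matchings: "finite matchings"
  by (rule finite_subset[of _ "whites \<rightarrow>\<^sub>E UNIV"]) (auto simp: matchings_def intro!: finite_PiE)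

lemma torus_matching_matchings: "\<kappa> \<in> matchings \<Longrightarrow> torus_matching l m \<kappa>"
  by unfold_locales (simp add: matchings_def)

lemma white_step_eq_below_iff:
  "w \<in> blacks \<Longrightarrow> z \<in> whites \<Longrightarrow> below m w = white_step l m k z \<longleftrightarrow> w = link_target l m k z"
  using inj_on_below link_target_black unfolding white_step_def by (metis inj_onD)

lemma white_step_eq_iff:
  "z \<in> whites \<Longrightarrow> z' \<in> whites \<Longrightarrow>
    white_step l m k z = white_step l m k' z' \<longleftrightarrow> link_target l m k z = link_target l m k' z'"
  using inj_on_below link_target_black unfolding white_step_def by (metis inj_onD)

lemma whites_blacks_disjoint: "z \<in> whites \<Longrightarrow> z \<notin> blacks"
  by (case_tac z) (auto simp: white_iff black_iff)

text \<open>Each link has exactly one white end, so a configuration selects one link per white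
  vertex. At black vertices, uniqueness is injectivity of the step map, and existence follows from
  it by finiteness.\<close>

lemma bij_betw_matchings:
  "bij_betw (\<lambda>\<kappa>. (\<lambda>z. (\<kappa> z, z)) ` whites) matchings {S. dimer_configuration l m S}"
proof (rule bij_betw_imageI)
  let ?F = "\<lambda>\<kappa> :: vertex \<Rightarrow> link_kind. (\<lambda>z. (\<kappa> z, z)) ` whites"
  show "inj_on ?F matchings"
  proof (rule inj_onI)
    fix \<kappa> \<kappa>' assume K: "\<kappa> \<in> matchings" "\<kappa>' \<in> matchings" and eq: "?F \<kappa> = ?F \<kappa>'"
    show "\<kappa> = \<kappa>'"
    proof (rule PiE_ext[of \<kappa> whites "\<lambda>_. UNIV" \<kappa>'])
      fix z assume "z \<in> whites"
      then have "(\<kappa> z, z) \<in> ?F \<kappa>'" using eq by blast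
      then show "\<kappa> z = \<kappa>' z" by auto
    qed (use K in \<open>auto simp: matchings_def\<close>)
  qed
  show "?F ` matchings = {S. dimer_configuration l m S}"
  proof (intro subset_antisym subsetI CollectI)
    fix S assume "S \<in> ?F ` matchings"
    then obtain \<kappa> where \<kappa>: "\<kappa> \<in> matchings" and S: "S = ?F \<kappa>" by blast
    interpret torus_matching l m \<kappa> using \<kappa> by (rule torus_matching_matchings)
    show "dimer_configuration l m S"
      unfolding dimer_configuration_def
    proof (intro conjI ballI)
      show "S \<subseteq> links l m" by (auto simp: S links_def)
      fix w assume w: "w \<in> whites \<union> blacks"
      show "\<exists>!e. e \<in> S \<and> w \<in> link_ends l m e"
      proof (cases "w \<in> whites")
        case True
        show ?thesis
        proof (rule ex1I[of _ "(\<kappa> w, w)"])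
          fix e assume e: "e \<in> S \<and> w \<in> link_ends l m e"
          then obtain z where z: "z \<in> whites" "e = (\<kappa> z, z)" by (auto simp: S)
          with True have "w \<noteq> link_target l m (\<kappa> z) z"
            using link_target_black whites_blacks_disjoint by blast
          with e z show "e = (\<kappa> w, w)" by simp
        qed (use True in \<open>auto simp: S\<close>)
      next
        case False
        then have w: "w \<in> blacks" using w by blast
        \<comment> \<open>The vertex below \<open>w\<close> has a preimage under the permutation,
          and the link chosen there ends in \<open>w\<close>.\<close>
        then obtain z where z: "z \<in> whites" "torus_perm z = below m w"
          using torus_perm_permutes below_white by (metis imageE permutes_image)
        then have tz: "w = link_target l m (\<kappa> z) z"
          using w by (metis torus_perm_white white_step_eq_below_iff)
        show ?thesis
        proof (rule ex1I[of _ "(\<kappa> z, z)"])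
          fix e assume e: "e \<in> S \<and> w \<in> link_ends l m e"
          then obtain z' where z': "z' \<in> whites" "e = (\<kappa> z', z')" by (auto simp: S)
          with e False have "w = link_target l m (\<kappa> z') z'" by auto
          then have "white_step l m (\<kappa> z) z = white_step l m (\<kappa> z') z'"
            using tz by (simp add: white_step_def)
          then have "z = z'" using inj_step z(1) z'(1) by (auto dest: inj_onD)
          then show "e = (\<kappa> z, z)" using z' by simp
        qed (use z tz in \<open>auto simp: S\<close>)
      qed
    qed
  next
    fix S assume "S \<in> {S. dimer_configuration l m S}"
    then have sub: "S \<subseteq> UNIV \<times> whites"
      and ex1: "w \<in> whites \<union> blacks \<Longrightarrow> \<exists>!e. e \<in> S \<and> w \<in> link_ends l m e" for w
      by (auto simp: dimer_configuration_def links_def)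
    have "\<exists>k. (k, z) \<in> S" if z: "z \<in> whites" for z
    proof -
      obtain k z' where e: "(k, z') \<in> S" "z \<in> link_ends l m (k, z')"
        using ex1[of z] z by auto
      then have "z' \<in> whites" using sub by auto
      with z have "z \<noteq> link_target l m k z'"
        using link_target_black whites_blacks_disjoint by blast
      with e have "z = z'" by simp
      with e show ?thesis by blast
    qed
    then obtain \<kappa>' where \<kappa>': "\<And>z. z \<in> whites \<Longrightarrow> (\<kappa>' z, z) \<in> S" by metis
    define \<kappa> where "\<kappa> = restrict \<kappa>' whites"
    have \<kappa>: "(\<kappa> z, z) \<in> S" if "z \<in> whites" for z using that \<kappa>' by (simp add: \<kappa>_def)
    have "S = ?F \<kappa>"
    proof (intro subset_antisym subsetI)
      fix e assume e: "e \<in> S"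
      then obtain k z where kz: "e = (k, z)" "z \<in> whites" using sub by auto
      have "z \<in> link_ends l m e" "z \<in> link_ends l m (\<kappa> z, z)" using kz by simp_all
      with ex1[of z] e \<kappa>[OF kz(2)] kz(2) have "e = (\<kappa> z, z)" by blast
      with kz show "e \<in> ?F \<kappa>" by blast
    next
      fix e assume "e \<in> ?F \<kappa>"
      then obtain z where "z \<in> whites" "e = (\<kappa> z, z)" by blast
      then show "e \<in> S" using \<kappa> by simp
    qed
    moreover have "\<kappa> \<in> matchings"
    proof -
      have "inj_on (\<lambda>z. white_step l m (\<kappa> z) z) whites"
      proof (rule inj_onI)
        fix z z' assume z: "z \<in> whites" "z' \<in> whites"
          and eq: "white_step l m (\<kappa> z) z = white_step l m (\<kappa> z') z'"
        then have "link_target l m (\<kappa> z) z = link_target l m (\<kappa> z') z'"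
          by (simp add: white_step_eq_iff)
        then have "link_target l m (\<kappa> z) z \<in> link_ends l m (\<kappa> z, z)"
          "link_target l m (\<kappa> z) z \<in> link_ends l m (\<kappa> z', z')" by simp_all
        with ex1[of "link_target l m (\<kappa> z) z"] link_target_black[OF z(1), of "\<kappa> z"] \<kappa>[OF z(1)] \<kappa>[OF z(2)]
        have "(\<kappa> z, z) = (\<kappa> z', z')" by blast
        then show "z = z'" by simp
      qed
      then show ?thesis by (simp add: matchings_def \<kappa>_def)
    qed
    ultimately show "S \<in> ?F ` matchings" by blast
  qed
qed

definition matching_exponents :: "(vertex \<Rightarrow> link_kind) \<Rightarrow> int \<times> int" where
  "matching_exponents \<kappa> = (\<Sum>z\<in>whites. step_exponents (\<kappa> z))"

lemma normalized_statistical_sum_eq: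
  assumes "\<And>z. z \<in> whites \<Longrightarrow> b z \<noteq> 0"
  shows "normalized_statistical_sum l m a b c d =
    (\<Sum>\<kappa>\<in>matchings. Poly_Mapping.single (matching_exponents \<kappa>)
       (\<Prod>z\<in>whites. relative_coeff a b c d (\<kappa> z) z))"
proof -
  have "statistical_sum l m a b c d =
      (\<Sum>\<kappa>\<in>matchings. \<Prod>e\<in>(\<lambda>z. (\<kappa> z, z)) ` whites. link_weight a b c d e)"
    unfolding statistical_sum_def by (rule sum.reindex_bij_betw[OF bij_betw_matchings, symmetric])
  also have "\<dots> = (\<Sum>\<kappa>\<in>matchings. \<Prod>z\<in>whites. link_weight a b c d (\<kappa> z, z))"
    by (simp add: prod.reindex inj_on_def)
  finally have "normalized_statistical_sum l m a b c d =
      (\<Sum>\<kappa>\<in>matchings. \<Prod>z\<in>whites. link_weight a b c d (\<kappa> z, z) * lconst (- inverse (b z)))"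
    by (simp add: normalized_statistical_sum_def sum_distrib_right prod.distrib)
  then show ?thesis
    using assms by (simp add: link_weight_single prod_single matching_exponents_def)
qed

section \<open>The operators and the determinant in terms of white vertices\<close>

lemma distinct_vertices: "distinct (white_vertices l m)" "distinct (black_vertices l m)"
  by (simp_all add: white_vertices_def black_vertices_def distinct_product)

lemma length_vertices: "length (black_vertices l m) = card whites" "length (white_vertices l m) = card whites"
  using distinct_card[OF distinct_vertices(1)] distinct_card[OF distinct_vertices(2)]
    card_blacks by simp_all

text \<open>Black row indices are identified with white vertices by descending the
  \<open>B\<close>-link, which turns the determinant into a sum over permutations of white
  vertices.\<close>

definition row_white :: "nat \<Rightarrow> vertex" where
  "row_white i = below m (black_vertices l m ! i)"

lemma row_black: "i < card whites \<Longrightarrow> black_vertices l m ! i \<in> blacks"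
  by (simp add: length_vertices)

lemma bij_betw_row_white: "bij_betw row_white {0..<card whites} whites"
proof -
  have "bij_betw ((!) (black_vertices l m)) {0..<card whites} blacks"
    using bij_betw_nth[OF distinct_vertices(2), of "{..<card whites}"]
    by (simp add: length_vertices lessThan_atLeast0)
  moreover have "bij_betw (below m) blacks whites"
    using inj_on_below below_image by (simp add: bij_betw_def)
  ultimately show ?thesis unfolding row_white_def
    using bij_betw_trans by (auto simp: comp_def)
qed

lemma row_white_white: "i < card whites \<Longrightarrow> row_white i \<in> whites"
  using bij_betw_row_white by (auto simp: bij_betw_def)

lemma sum_row_white: "(\<Sum>i = 0..<card whites. f (row_white i)) = (\<Sum>z\<in>whites. f z)"
  using bij_betw_row_white by (rule sum.reindex_bij_betw)

lemma row_white_eq_iff: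
  "i < card whites \<Longrightarrow> j < card whites \<Longrightarrow> row_white i = row_white j \<longleftrightarrow> i = j"
  using bij_betw_row_white by (auto simp: bij_betw_def inj_on_def)

text \<open>For \<open>w\<close> divided by \<open>b\<close>, this is the matrix of an operator
  composed with the inverse of \<open>B\<close>.\<close>

definition step_mat :: "link_kind \<Rightarrow> (vertex \<Rightarrow> complex) \<Rightarrow> complex mat" where
  "step_mat k w = mat (card whites) (card whites)
     (\<lambda>(i, j). if row_white i = white_step l m k (row_white j) then w (row_white j) else 0)"

lemma link_operator_entry:
  assumes "i < card whites" "j < card whites"
  shows "link_operator l m k w $$ (i, j) =
    (if row_white i = white_step l m k (white_vertices l m ! j) then w (white_vertices l m ! j) else 0)"
  using assms white_step_eq_below_iff[OF row_black, of i "white_vertices l m ! j" k]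
  by (simp add: link_operator_def length_vertices row_white_def)

lemma link_operator_carrier: "link_operator l m k w \<in> carrier_mat (card whites) (card whites)"
  by (simp add: link_operator_def length_vertices)

lemma white_step_LinkB: "z \<in> whites \<Longrightarrow> white_step l m LinkB z = z"
  by (simp add: white_step_def below_target_LinkB)

text \<open>\<open>B\<close> only moves each white basis vector to the black vertex above and
  multiplies it by \<open>b\<close>, so one term of the matrix product survives.\<close>

lemma link_operator_eq_step_mat:
  "link_operator l m k w = step_mat k (\<lambda>z. w z / b z) * link_operator l m LinkB b"
  if b: "\<And>z. z \<in> whites \<Longrightarrow> b z \<noteq> 0"
proof (rule eq_matI)
  fix i j assume "i < dim_row (step_mat k (\<lambda>z. w z / b z) * link_operator l m LinkB b)"
    "j < dim_col (step_mat k (\<lambda>z. w z / b z) * link_operator l m LinkB b)"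
  then have ij: "i < card whites" "j < card whites"
    by (simp_all add: step_mat_def link_operator_def length_vertices)
  define z where "z = white_vertices l m ! j"
  have z: "z \<in> whites" using ij(2) by (simp add: z_def length_vertices)
  define f where "f = (\<lambda>y. if y = z then (if row_white i = white_step l m k y then w y else 0) else 0)"
  have "(step_mat k (\<lambda>z. w z / b z) * link_operator l m LinkB b) $$ (i, j) =
      (\<Sum>r = 0..<card whites. step_mat k (\<lambda>z. w z / b z) $$ (i, r) * link_operator l m LinkB b $$ (r, j))"
    using ij link_operator_carrier[of LinkB b]
    by (simp add: step_mat_def scalar_prod_def link_operator_def length_vertices)
  also have "\<dots> = (\<Sum>r = 0..<card whites. f (row_white r))"
    using ij z b by (intro sum.cong)
      (auto simp: f_def link_operator_entry white_step_LinkB step_mat_def row_white_white simp flip: z_def)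
  also have "\<dots> = (if row_white i = white_step l m k z then w z else 0)"
    unfolding sum_row_white using z by (simp add: f_def)
  finally show "link_operator l m k w $$ (i, j) =
      (step_mat k (\<lambda>z. w z / b z) * link_operator l m LinkB b) $$ (i, j)"
    using ij by (simp add: link_operator_entry z_def)
qed (simp_all add: step_mat_def link_operator_def length_vertices)

lemma link_operator_mult_inverse:
  assumes b: "\<And>z. z \<in> whites \<Longrightarrow> b z \<noteq> 0"
  shows "link_operator l m k w * the (mat_inverse (link_operator l m LinkB b)) = step_mat k (\<lambda>z. w z / b z)"
proof -
  define n where "n = card whites"
  \<comment> \<open>The explicit inverse of \<open>B\<close>: descend the \<open>B\<close>-link and
    divide by its number.\<close>
  define B' where "B' = mat n n (\<lambda>(j, i). if white_vertices l m ! j = row_white i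
    then inverse (b (row_white i)) else 0)"
  have "link_operator l m LinkB b * B' = 1\<^sub>m n"
  proof (rule eq_matI)
    fix i j assume "i < dim_row (1\<^sub>m n :: complex mat)" "j < dim_col (1\<^sub>m n :: complex mat)"
    then have ij: "i < n" "j < n" by simp_all
    define f :: "vertex \<Rightarrow> complex" where
      "f = (\<lambda>y. if y = row_white j then (if row_white i = row_white j then 1 else 0) else 0)"
    have "(link_operator l m LinkB b * B') $$ (i, j) =
        (\<Sum>r = 0..<n. link_operator l m LinkB b $$ (i, r) * B' $$ (r, j))"
      using ij link_operator_carrier[of LinkB b]
      by (simp add: scalar_prod_def link_operator_def length_vertices B'_def flip: n_def)
    also have "\<dots> = (\<Sum>r = 0..<n. f (white_vertices l m ! r))"
      using ij b row_white_white
      by (intro sum.cong) (auto simp: f_def link_operator_entry white_step_LinkB B'_def length_vertices n_def)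
    also have "\<dots> = (if row_white i = row_white j then 1 else 0)"
      using sum_nth_set[OF distinct_vertices(1), of f] row_white_white[of j] ij
      by (simp add: f_def length_vertices flip: n_def)
    also have "\<dots> = 1\<^sub>m n $$ (i, j)"
      using ij row_white_eq_iff[of i j] by (simp add: n_def)
    finally show "(link_operator l m LinkB b * B') $$ (i, j) = 1\<^sub>m n $$ (i, j)" .
  qed (simp_all add: B'_def link_operator_def length_vertices n_def)
  then have "step_mat k (\<lambda>z. w z / b z) * link_operator l m LinkB b
      * the (mat_inverse (link_operator l m LinkB b)) = step_mat k (\<lambda>z. w z / b z)"
    by (intro mat_inverse_mult_eq[where B' = B' and n = n])
      (simp_all add: link_operator_carrier B'_def step_mat_def n_def)
  moreover have "link_operator l m k w = step_mat k (\<lambda>z. w z / b z) * link_operator l m LinkB b"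
    using b by (rule link_operator_eq_step_mat)
  ultimately show ?thesis by (simp only:)
qed

text \<open>Each entry in the Leibniz formula is split by link kind, which keeps parallel links
  apart when \<open>l = 2\<close> or \<open>m = 2\<close>. A permutation and a choice of kinds
  contribute only if the choice is a matching and the permutation is its
  \<open>torus_perm\<close>.\<close>

lemma lattice_det_eq:
  assumes b: "\<And>z. z \<in> whites \<Longrightarrow> b z \<noteq> 0"
  shows "lattice_det l m a b c d =
    (\<Sum>\<kappa>\<in>matchings. Poly_Mapping.single (matching_exponents \<kappa>)
       (of_int (sign (torus_matching.torus_perm l m \<kappa>) * (-1) ^ card {z \<in> whites. \<kappa> z \<noteq> LinkB})
         * (\<Prod>z\<in>whites. relative_coeff a b c d (\<kappa> z) z)))"
proof -
  define n where "n = card whites"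
  \<comment> \<open>The contribution of a link to a matrix entry: the relative weight, with opposite
    sign for links other than \<open>B\<close>-links.\<close>
  define g where "g k z = Poly_Mapping.single (step_exponents k)
    ((if k = LinkB then 1 else -1) * relative_coeff a b c d k z)" for k z
  define F where "F z' z = (\<Sum>k\<in>UNIV. if z' = white_step l m k z then g k z else 0)" for z' z
  define M where "M = 1\<^sub>m n + var_u \<cdot>\<^sub>m map_mat lconst (step_mat LinkA (\<lambda>z. a z / b z))
      - var_v \<cdot>\<^sub>m map_mat lconst (step_mat LinkD (\<lambda>z. d z / b z))
      - (var_u * var_v) \<cdot>\<^sub>m map_mat lconst (step_mat LinkC (\<lambda>z. c z / b z))"
  have M_carrier: "M \<in> carrier_mat n n"
    by (auto simp: M_def step_mat_def n_def intro!: carrier_matI)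
  have entry: "M $$ (i, j) = F (row_white i) (row_white j)" if ij: "i < n" "j < n" for i j
  proof -
    have g: "g LinkA z = var_u * lconst (a z / b z)" "g LinkB z = 1"
      "g LinkC z = - (var_u * var_v * lconst (c z / b z))" "g LinkD z = - (var_v * lconst (d z / b z))" for z
      by (simp_all add: g_def var_u_def var_v_def lconst_def mult_single flip: single_uminus zero_prod_def)
    have 0: "lconst 0 = 0" by (simp add: lconst_def)
    have "i = j \<longleftrightarrow> row_white i = white_step l m LinkB (row_white j)"
      using ij row_white_eq_iff[of i j] row_white_white[of j] by (simp add: white_step_LinkB n_def)
    then show ?thesis
      using ij by (simp add: M_def F_def link_kind_UNIV g step_mat_def 0 flip: n_def)
  qed
  have inverse: "link_operator l m k w * the (mat_inverse (link_operator l m LinkB b)) =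
      step_mat k (\<lambda>z. w z / b z)" for k w
    using b by (rule link_operator_mult_inverse)
  have "lattice_det l m a b c d = det M"
    unfolding lattice_det_def Let_def inverse M_def
    by (simp add: length_vertices n_def)
  also have "\<dots> = (\<Sum>p | p permutes {0..<n}. of_int (sign p) * (\<Prod>j\<in>{0..<n}. F (row_white (p j)) (row_white j)))"
  proof -
    have "M $$ (p j, j) = F (row_white (p j)) (row_white j)"
      if "p permutes {0..<n}" "j \<in> {0..<n}" for p j
      using that permutes_in_image[OF that(1), of j] by (intro entry) auto
    then show ?thesis
      unfolding det_col[OF M_carrier] lessThan_atLeast0 by (intro sum.cong) auto
  qed
  also have "\<dots> = (\<Sum>q | q permutes whites. of_int (sign q) * (\<Prod>z\<in>whites. F (q z) z))"
    using bij_betw_row_white by (intro sum_permutes_reindex) (simp_all add: n_def)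
  also have "\<dots> = (\<Sum>q | q permutes whites. \<Sum>\<kappa>\<in>whites \<rightarrow>\<^sub>E UNIV. of_int (sign q) *
      (\<Prod>z\<in>whites. if q z = white_step l m (\<kappa> z) z then g (\<kappa> z) z else 0))"
    by (simp add: F_def prod_sum_PiE sum_distrib_left)
  also have "\<dots> = (\<Sum>\<kappa>\<in>whites \<rightarrow>\<^sub>E UNIV. \<Sum>q | q permutes whites. of_int (sign q) *
      (\<Prod>z\<in>whites. if q z = white_step l m (\<kappa> z) z then g (\<kappa> z) z else 0))"
    by (rule sum.swap)
  \<comment> \<open>For fixed \<kappa> the product vanishes unless \<open>q\<close> is the step map
    on all white vertices. Such a permutation exists only if the step map is injective, and it is
    then unique.\<close>
  also have "\<dots> = (\<Sum>\<kappa>\<in>whites \<rightarrow>\<^sub>E UNIV. if \<kappa> \<in> matchings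
      then of_int (sign (torus_matching.torus_perm l m \<kappa>)) * (\<Prod>z\<in>whites. g (\<kappa> z) z) else 0)"
  proof (rule sum.cong)
    fix \<kappa> :: "vertex \<Rightarrow> link_kind" assume \<kappa>: "\<kappa> \<in> whites \<rightarrow>\<^sub>E UNIV"
    let ?t = "\<lambda>q. of_int (sign q) * (\<Prod>z\<in>whites. if q z = white_step l m (\<kappa> z) z then g (\<kappa> z) z else 0)"
    have vanish: "?t q = 0" if "\<exists>z\<in>whites. q z \<noteq> white_step l m (\<kappa> z) z" for q
    proof -
      have "(\<Prod>z\<in>whites. if q z = white_step l m (\<kappa> z) z then g (\<kappa> z) z else 0) = 0"
        using that by (intro prod_zero) (auto intro: bexI)
      then show ?thesis by simp
    qed
    show "(\<Sum>q | q permutes whites. ?t q) = (if \<kappa> \<in> matchings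
      then of_int (sign (torus_matching.torus_perm l m \<kappa>)) * (\<Prod>z\<in>whites. g (\<kappa> z) z) else 0)"
    proof (cases "\<kappa> \<in> matchings")
      case True
      interpret torus_matching l m \<kappa> using True by (rule torus_matching_matchings)
      have "?t q = 0" if "q permutes whites" "q \<noteq> torus_perm" for q
      proof (rule vanish, rule ccontr)
        assume "\<not> (\<exists>z\<in>whites. q z \<noteq> white_step l m (\<kappa> z) z)"
        then have "q z = torus_perm z" if "z \<in> whites" for z
          using that by (simp add: torus_perm_white)
        moreover have "q z = torus_perm z" if "z \<notin> whites" for z
          using that \<open>q permutes whites\<close> torus_perm_permutes by (simp add: permutes_not_in)
        ultimately show False using that(2) by blast
      qed
      then have "(\<Sum>q | q permutes whites. ?t q) = (\<Sum>q\<in>{torus_perm}. ?t q)"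
        using torus_perm_permutes by (intro sum.mono_neutral_right) (auto simp: finite_permutations)
      then show ?thesis using True by (simp add: torus_perm_white)
    next
      case False
      have "?t q = 0" if "q permutes whites" for q
      proof (rule vanish, rule ccontr)
        assume "\<not> (\<exists>z\<in>whites. q z \<noteq> white_step l m (\<kappa> z) z)"
        then have "inj_on (\<lambda>z. white_step l m (\<kappa> z) z) whites"
          using permutes_inj_on[OF that, of whites] by (simp add: inj_on_def)
        with False \<kappa> show False by (simp add: matchings_def)
      qed
      then show ?thesis using False by simp
    qed
  qed simp
  also have "\<dots> = (\<Sum>\<kappa>\<in>matchings. of_int (sign (torus_matching.torus_perm l m \<kappa>)) * (\<Prod>z\<in>whites. g (\<kappa> z) z))"
    by (intro sum.mono_neutral_cong_right) (auto simp: matchings_def intro!: finite_PiE)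
  also have "\<dots> = (\<Sum>\<kappa>\<in>matchings. Poly_Mapping.single (matching_exponents \<kappa>)
       (of_int (sign (torus_matching.torus_perm l m \<kappa>) * (-1) ^ card {z \<in> whites. \<kappa> z \<noteq> LinkB})
         * (\<Prod>z\<in>whites. relative_coeff a b c d (\<kappa> z) z)))"
  proof (rule sum.cong)
    fix \<kappa> assume "\<kappa> \<in> matchings"
    have "(\<Prod>z\<in>whites. if \<kappa> z = LinkB then 1 else -1 :: complex) = (-1) ^ card {z \<in> whites. \<kappa> z \<noteq> LinkB}"
      by (simp add: prod.If_cases Int_def)
    then show "of_int (sign (torus_matching.torus_perm l m \<kappa>)) * (\<Prod>z\<in>whites. g (\<kappa> z) z) =
      Poly_Mapping.single (matching_exponents \<kappa>)
       (of_int (sign (torus_matching.torus_perm l m \<kappa>) * (-1) ^ card {z \<in> whites. \<kappa> z \<noteq> LinkB})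
         * (\<Prod>z\<in>whites. relative_coeff a b c d (\<kappa> z) z))"
      by (simp add: g_def prod_single prod.distrib matching_exponents_def mult_single mult.assoc
          flip: single_of_int)
  qed simp
  finally show ?thesis .
qed

text \<open>\<open>cycle_exponents\<close> maps torus cycles onto periods, with inverse
  \<open>(i, j)\<close> to \<open>(i - j, - (i + j))\<close>, so bases correspond. It is linear on
  cycles with determinant \<open>- 1/2\<close>, which turns \<open>l * m\<close> into the number of
  white vertices.\<close>

lemma torus_homology_basis_exponents:
  assumes "torus_homology_basis l m P Q"
  shows "period l m (cycle_exponents P)" "period l m (cycle_exponents Q)"
    and "period l m v \<Longrightarrow> \<exists>k. v = laurent_exponents (cycle_exponents P) (cycle_exponents Q) k"
    and "\<bar>fst (cycle_exponents P) * snd (cycle_exponents Q)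
      - snd (cycle_exponents P) * fst (cycle_exponents Q)\<bar> = int (card whites)"
proof -
  obtain p1 p2 where P: "P = (l * p1, m * p2)"
    using assms by (cases P) (auto simp: torus_homology_basis_def torus_cycle_def elim!: dvdE)
  obtain q1 q2 where Q: "Q = (l * q1, m * q2)"
    using assms by (cases Q) (auto simp: torus_homology_basis_def torus_cycle_def elim!: dvdE)
  obtain a1 b1 where e: "cycle_exponents P = (a1, b1)" by force
  obtain a2 b2 where e': "cycle_exponents Q = (a2, b2)" by force
  \<comment> \<open>Evenness makes the halvings in \<open>cycle_exponents\<close> exact.\<close>
  have "even (l * p1)" "even (m * p2)" "even (l * q1)" "even (m * q2)"
    using l_even m_even by simp_all
  with e e' have ab: "a1 - b1 = l * p1" "a1 + b1 = - (m * p2)" "a2 - b2 = l * q1" "a2 + b2 = - (m * q2)"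
    unfolding P Q by (auto elim!: evenE)
  show "period l m (cycle_exponents P)" "period l m (cycle_exponents Q)"
    unfolding e e' period_def by (simp_all add: ab)
  have span: "\<exists>n1 n2. R = (n1 * (l * p1) + n2 * (l * q1), n1 * (m * p2) + n2 * (m * q2))"
    if "torus_cycle l m R" for R
  proof -
    have "\<exists>n. R = (fst n * fst P + snd n * fst Q, fst n * snd P + snd n * snd Q)"
      using assms[unfolded torus_homology_basis_def, THEN conjunct2, THEN conjunct2, rule_format, OF that]
      by (rule ex1_implies_ex)
    then show ?thesis unfolding P Q fst_conv snd_conv by blast
  qed
  {
    assume v: "period l m v"
    then have "torus_cycle l m (fst v - snd v, - (fst v + snd v))"
      unfolding torus_cycle_def period_def fst_conv snd_conv dvd_minus_iff .
    then obtain n1 n2 where "(fst v - snd v, - (fst v + snd v)) =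
        (n1 * (l * p1) + n2 * (l * q1), n1 * (m * p2) + n2 * (m * q2))"
      using span by blast
    then have "fst v - snd v = n1 * (a1 - b1) + n2 * (a2 - b2)"
      "fst v + snd v = n1 * (a1 + b1) + n2 * (a2 + b2)"
      unfolding ab by simp_all
    then have "v = laurent_exponents (a1, b1) (a2, b2) (n1, n2)"
      by (simp add: laurent_exponents_def prod_eq_iff algebra_simps)
    then show "\<exists>k. v = laurent_exponents (cycle_exponents P) (cycle_exponents Q) k"
      unfolding e e' by blast
  }
  \<comment> \<open>Expressing the standard generators in \<open>P\<close> and \<open>Q\<close>
    gives an integer inverse of the coordinate matrix, whose determinant is therefore a
    unit.\<close>
  have "torus_cycle l m (l, 0)" "torus_cycle l m (0, m)" by (simp_all add: torus_cycle_def)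
  then obtain n1 n2 n3 n4 where
    "(l, 0) = (n1 * (l * p1) + n2 * (l * q1), n1 * (m * p2) + n2 * (m * q2))"
    "(0, m) = (n3 * (l * p1) + n4 * (l * q1), n3 * (m * p2) + n4 * (m * q2))"
    using span by metis
  then have "l * 1 = l * (n1 * p1 + n2 * q1)" "m * 0 = m * (n1 * p2 + n2 * q2)"
    "l * 0 = l * (n3 * p1 + n4 * q1)" "m * 1 = m * (n3 * p2 + n4 * q2)"
    by (simp_all add: algebra_simps)
  then have n: "n1 * p1 + n2 * q1 = 1" "n1 * p2 + n2 * q2 = 0" "n3 * p1 + n4 * q1 = 0" "n3 * p2 + n4 * q2 = 1"
    using l_pos m_pos by (simp_all only: mult_cancel_left) simp_all
  have "(n1 * n4 - n2 * n3) * (p1 * q2 - p2 * q1) =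
      (n1 * p1 + n2 * q1) * (n3 * p2 + n4 * q2) - (n1 * p2 + n2 * q2) * (n3 * p1 + n4 * q1)"
    by (simp add: algebra_simps)
  then have unit: "\<bar>p1 * q2 - p2 * q1\<bar> = 1"
    unfolding n by (metis abs_zmult_eq_1 diff_zero mult.commute mult_1 abs_1 mult_zero_left)
  have "2 * (a1 * b2 - b1 * a2) = (a1 + b1) * (a2 - b2) * - 1 + (a1 - b1) * (a2 + b2)"
    by (simp add: algebra_simps)
  also have "\<dots> = - (l * m * (p1 * q2 - p2 * q1))"
    unfolding ab by (simp add: algebra_simps)
  finally have "\<bar>2 * (a1 * b2 - b1 * a2)\<bar> = l * m"
    using unit l_pos m_pos by (simp add: abs_mult)
  then show "\<bar>fst (cycle_exponents P) * snd (cycle_exponents Q)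
      - snd (cycle_exponents P) * fst (cycle_exponents Q)\<bar> = int (card whites)"
    using double_card_whites unfolding e e' by (simp add: abs_mult)
qed

end

lemma (in torus_matching) matching_exponents_eq: "matching_exponents \<kappa> = (total_right, total_up)"
proof -
  have "step_exponents k = (of_bool (k = LinkA) + of_bool (k = LinkC), of_bool (k = LinkC) + of_bool (k = LinkD))" for k
    by (cases k) simp_all
  then show ?thesis
    by (simp add: matching_exponents_def sum_pair sum.distrib uses_def Int_def)
qed

section \<open>Comparison of coefficients in \<open>x\<close> and \<open>y\<close>\<close>

theorem lemma4p3:
  fixes l m :: int
    and a b c d :: "int \<times> int \<Rightarrow> complex"
    and P Q :: "int \<times> int"
  assumes "l > 0" "even l" "m > 0" "even m"
    and "\<forall>z \<in> set (white_vertices l m). a z \<noteq> 0 \<and> b z \<noteq> 0 \<and> c z \<noteq> 0 \<and> d z \<noteq> 0"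
    and "torus_homology_basis l m P Q"
  shows "(\<exists>!f. in_variables_uv P Q f = lattice_det l m a b c d) \<and>
    (\<exists>!s. in_variables_uv P Q s = normalized_statistical_sum l m a b c d) \<and>
    (\<forall>f s. in_variables_uv P Q f = lattice_det l m a b c d \<and>
           in_variables_uv P Q s = normalized_statistical_sum l m a b c d \<longrightarrow>
      s = lconst (1/2) * (- f + sign_change (-1) 1 f + sign_change 1 (-1) f + sign_change (-1) (-1) f) \<and>
      f = lconst (1/2) * (- s + sign_change (-1) 1 s + sign_change 1 (-1) s + sign_change (-1) (-1) s))"
proof -
  interpret even_torus l m by unfold_locales fact+
  have b: "b z \<noteq> 0" if "z \<in> whites" for z using assms(5) that by blast
  define e e' where "e = cycle_exponents P" and "e' = cycle_exponents Q"
  note basis = torus_homology_basis_exponents[OF assms(6), folded e_def e'_def]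
  have "card whites > 0" using double_card_whites mult_pos_pos[OF l_pos m_pos] by linarith
  with basis(4) have inj: "inj (laurent_exponents e e')"
    by (intro inj_laurent_exponents) auto
  define coeff where "coeff \<kappa> = (\<Prod>z\<in>whites. relative_coeff a b c d (\<kappa> z) z)" for \<kappa>
  \<comment> \<open>The exponent vector of a matching is a period, hence that of a monomial in
    \<open>x\<close> and \<open>y\<close>; the sign by which determinant and statistical sum differ
    depends only on the parities of its exponents.\<close>
  have "\<forall>\<kappa>\<in>matchings. \<exists>k. matching_exponents \<kappa> = laurent_exponents e e' k \<and>
      of_int (sign (torus_matching.torus_perm l m \<kappa>) * (-1) ^ card {z \<in> whites. \<kappa> z \<noteq> LinkB}) = parity_sign k"
  proof
    fix \<kappa> assume \<kappa>: "\<kappa> \<in> matchings"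
    interpret torus_matching l m \<kappa> using \<kappa> by (rule torus_matching_matchings)
    obtain k where k: "matching_exponents \<kappa> = laurent_exponents e e' k"
      using basis(3) total_exponents_period unfolding matching_exponents_eq by blast
    obtain a1 b1 where e: "e = (a1, b1)" by force
    obtain a2 b2 where e': "e' = (a2, b2)" by force
    have "sign torus_perm * (-1) ^ card {z \<in> whites. \<kappa> z \<noteq> LinkB} =
        (if even (fst k) \<and> even (snd k) then 1 else -1)"
    proof (rule sign_torus_perm)
      show "period l m (a1, b1)" "period l m (a2, b2)" using basis(1,2) by (simp_all add: e e')
      show "\<exists>r s. v = (r * a1 + s * a2, r * b1 + s * b2)" if "period l m v" for v
        using basis(3)[OF that] by (auto simp: e e' laurent_exponents_def)
      show "\<bar>a1 * b2 - b1 * a2\<bar> = int (card whites)" using basis(4) by (simp add: e e')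
      show "total_right = fst k * a1 + snd k * a2" "total_up = fst k * b1 + snd k * b2"
        using k by (simp_all add: matching_exponents_eq laurent_exponents_def e e')
    qed
    then have "of_int (sign torus_perm * (-1) ^ card {z \<in> whites. \<kappa> z \<noteq> LinkB}) = parity_sign k"
      unfolding parity_sign_def by (simp del: of_int_mult)
    then show "\<exists>k. matching_exponents \<kappa> = laurent_exponents e e' k \<and>
        of_int (sign torus_perm * (-1) ^ card {z \<in> whites. \<kappa> z \<noteq> LinkB}) = parity_sign k"
      using k by blast
  qed
  from bchoice[OF this] obtain k where k:
    "\<And>\<kappa>. \<kappa> \<in> matchings \<Longrightarrow> matching_exponents \<kappa> = laurent_exponents e e' (k \<kappa>)"
    "\<And>\<kappa>. \<kappa> \<in> matchings \<Longrightarrow> of_int (sign (torus_matching.torus_perm l m \<kappa>)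
        * (-1) ^ card {z \<in> whites. \<kappa> z \<noteq> LinkB}) = parity_sign (k \<kappa>)"
    by blast
  \<comment> \<open>Explicit Laurent polynomials in \<open>x\<close> and \<open>y\<close>;
    injectivity of the substitution makes them the only candidates.\<close>
  define s0 f0 where "s0 = (\<Sum>\<kappa>\<in>matchings. Poly_Mapping.single (k \<kappa>) (coeff \<kappa>))"
    and "f0 = (\<Sum>\<kappa>\<in>matchings. Poly_Mapping.single (k \<kappa>) (parity_sign (k \<kappa>) * coeff \<kappa>))"
  have s0: "in_variables_uv P Q s0 = normalized_statistical_sum l m a b c d"
  proof -
    have "normalized_statistical_sum l m a b c d =
        (\<Sum>\<kappa>\<in>matchings. Poly_Mapping.single (matching_exponents \<kappa>) (coeff \<kappa>))"
      unfolding coeff_def using b by (rule normalized_statistical_sum_eq)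
    also have "\<dots> = in_variables_uv P Q s0"
      unfolding in_variables_uv_def e_def[symmetric] e'_def[symmetric] s0_def
        lsubst_sum_single[OF inj finite_matchings]
      by (intro sum.cong) (simp_all only: k)
    finally show ?thesis by simp
  qed
  have f0: "in_variables_uv P Q f0 = lattice_det l m a b c d"
  proof -
    have "lattice_det l m a b c d = (\<Sum>\<kappa>\<in>matchings. Poly_Mapping.single (matching_exponents \<kappa>)
       (of_int (sign (torus_matching.torus_perm l m \<kappa>) * (-1) ^ card {z \<in> whites. \<kappa> z \<noteq> LinkB})
         * coeff \<kappa>))"
      unfolding coeff_def using b by (rule lattice_det_eq)
    also have "\<dots> = in_variables_uv P Q f0"
      unfolding in_variables_uv_def e_def[symmetric] e'_def[symmetric] f0_def
        lsubst_sum_single[OF inj finite_matchings]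
      by (intro sum.cong) (simp_all only: k)
    finally show ?thesis by simp
  qed
  have unique: "f = g" if "in_variables_uv P Q f = in_variables_uv P Q g" for f g
    using that inj_lsubst[OF inj] unfolding in_variables_uv_def e_def e'_def by (rule injD[rotated])
  have lookup_f0: "Poly_Mapping.lookup f0 j = parity_sign j * Poly_Mapping.lookup s0 j" for j
    by (auto simp: f0_def s0_def lookup_sum lookup_single when_def sum_distrib_left intro!: sum.cong)
  \<comment> \<open>\<open>parity_sign\<close> squares to 1, so the same average leads from
    \<open>f0\<close> back to \<open>s0\<close>.\<close>
  have "s0 = lconst (1/2) * (- f0 + sign_change (-1) 1 f0 + sign_change 1 (-1) f0 + sign_change (-1) (-1) f0)"
    by (rule poly_mapping_eqI) (simp only: sign_change_average lookup_f0, simp add: parity_sign_def)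
  moreover have "f0 = lconst (1/2) * (- s0 + sign_change (-1) 1 s0 + sign_change 1 (-1) s0 + sign_change (-1) (-1) s0)"
    by (rule poly_mapping_eqI) (simp only: sign_change_average lookup_f0)
  moreover have "\<exists>!f. in_variables_uv P Q f = lattice_det l m a b c d"
    using f0 unique by (intro ex1I[of _ f0]) simp_all
  moreover have "\<exists>!s. in_variables_uv P Q s = normalized_statistical_sum l m a b c d"
    using s0 unique by (intro ex1I[of _ s0]) simp_all
  moreover have "f = f0" "s = s0" if "in_variables_uv P Q f = lattice_det l m a b c d \<and>
      in_variables_uv P Q s = normalized_statistical_sum l m a b c d" for f s
    using that s0 f0 unique by simp_all
  ultimately show ?thesis by blast
qed

end
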